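(* In the random graph model described in the context, almost surely infinitely many of the bottleneck events $\mathcal{B}_i=\{L(t_i)\le b\}\cap A_i\cap B_i\cap C_i$, $i=1,2,\dots$, occur.
   Context: **Model.** Fix an integer $M\ge 2$, integers $0<h_1<h_2<\dots<h_M$, numbers $p_{\Theta,1},\dots,p_{\Theta,M}>0$ with $\sum_k p_{\Theta,k}=1$, a finite nonempty set $I_\epsilon$ of positive integers with minimum $\epsilon_{min}$ and maximum $\epsilon_{max}$, and numbers $p_{\epsilon,j}>0$ ($j\in I_\epsilon$) with $\sum_j p_{\epsilon,j}=1$. Put $t_n:=n$; times and integers are identified. Vertices are labelled $0,1,2,\dots$; vertex $0$ is present at time $t_0$, and vertex $n\ge1$ arrives at time $t_n$. A pair $(i,j)$ denotes a directed edge from $i$ to $j$ ($j$ is then a parent of $i$). Each vertex $n\ge 1$ carries random variables $\Theta_n\in\{h_1,\dots,h_M\}$ (its proof-of-work, POW, duration), $\epsilon_n\in I_\epsilon$ (lag), and $X_n,Y_n$ (its two, possibly equal, parents). The directed graphs $\mathcal{G}(t_n)=(\mathcal{V}(t_n),\mathcal{E}(t_n))$ are defined by $\mathcal{V}(t_0)=\{0\}$, $\mathcal{E}(t_0)=\emptyset$, $$\mathcal{V}(t_{n+1})=\mathcal{V}(t_n)\cup\{k\ge1: t_k+\Theta_k=t_n\},\qquad \mathcal{E}(t_{n+1})=\mathcal{E}(t_n)\cup\{(k,X_k),(k,Y_k): k\ge 1,\ t_k+\Theta_k=t_n\},$$ and $\mathcal{G}(t_n):=\mathcal{G}(t_0)$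 for $n<0$. The set of tips is $\mathcal{L}(t_n):=\{v\in\mathcal{V}(t_n): (i,v)\notin\mathcal{E}(t_n)\text{ for all }i\}$, and $L(t_n):=|\mathcal{L}(t_n)|$. Let $\Sigma_n$ be the $\sigma$-algebra generated by $\Theta_m,\epsilon_m,X_m,Y_m$, $1\le m\le n$. The law is determined by $$\mathbb{P}(\Theta_n=h_k,\epsilon_n=j,X_n=v,Y_n=v'\mid\Sigma_{n-1})=\frac{p_{\Theta,k}\,p_{\epsilon,j}}{L(t_n-j)^2}\,1_{\{v,v'\in\mathcal{L}(t_n-j)\}}$$ for $n\ge1$, $1\le k\le M$, $j\in I_\epsilon$. **Unfinished vertices, pending and free tips.** $\mathcal{V}'(t_n):=\{i: 0\le i<n\}\setminus\mathcal{V}(t_n)$; $\mathcal{E}'(t_n):=\{(i,X_i),(i,Y_i): i\in\mathcal{V}'(t_n)\}$; pending tips $\mathcal{W}(t_n):=\{i\in\mathcal{L}(t_n): (j,i)\in\mathcal{E}'(t_n)\text{ for some }j\}$; free tips $\mathcal{F}(t_n):=\mathcal{L}(t_n)\setminus\mathcal{W}(t_n)$, $F(t_n):=|\mathcal{F}(t_n)|$. **Constants.** $b$ is a fixed constant in $(10h_M-6h_1+3M\epsilon_{max}+2,\infty)$. $\kappa_A$ is a fixed integer with $\kappa_A>1+\max\{2h_M,\,3h_M(h_M+\epsilon_{min})/(h_M-1)\}$, chosen such that for every $i$, on $\{L(t_i)\le b\}\cap A_i$ ($A_i$ defined below) one has $F(t_i+\kappa_A)-F(t_i+h_M)>3(h_M+\epsilon_{min})$,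 hence $F(t_i+\kappa_A)>3(h_M+\epsilon_{min})$. Further $\kappa_B:=\kappa_A+\epsilon_{min}+1$ and $\kappa_C:=\kappa_B+2(b+M\kappa_B+h_M)^2+h_M+\epsilon_{max}+1$. **Event $A_i$.** Every vertex $j\in[t_i,t_i+\kappa_A)$ satisfies $\epsilon_j=\epsilon_{min}$, $\Theta_j=h_M$, and $X_j=Y_j$, where $X_j\in\mathcal{L}(t_j-\epsilon_{min})\setminus\mathcal{F}(t_j)$ if $\mathcal{L}(t_j-\epsilon_{min})\not\subseteq\mathcal{F}(t_j)$, and $X_j\in\mathcal{L}(t_j-\epsilon_{min})$ otherwise. **Event $B_i$** (considered when $\{L(t_i)\le b\}\cap A_i$ occurs). Let $\mathcal{F}_i^B$ be the set of the $2(h_M+\epsilon_{min})$ smallest elements of $\mathcal{F}(t_i+\kappa_A)$. $B_i$ is the event that every vertex $j\in[t_i+\kappa_A,t_i+\kappa_B)$ satisfies $\Theta_j=h_M$, $\epsilon_j=\epsilon_{min}$, and $X_j=Y_j\in\mathcal{L}(t_j-\epsilon_{min})\setminus\mathcal{F}_i^B$. **Labels $(i,j,k)$.** Let $c_i:=|\mathcal{F}(t_i+\kappa_B)\cup\mathcal{V}'(t_i+\kappa_B)|=F(t_i+\kappa_B)+|\mathcal{V}'(t_i+\kappa_B)|$. For $1\le k\le c_i$, let $\xi(i,1,k)$ be the $k$-th smallest element of $\mathcal{F}(t_i+\kappa_B)\cup\mathcal{V}'(t_i+\kappa_B)$, and for $j\ge2$ let $\xi(i,j,k):=t_i+\kappa_B-1+(j-2)c_i+k$.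 The vertex $\xi(i,j,k)$ is also denoted $(i,j,k)$. **Event $C_i$** (considered when $\{L(t_i)\le b\}\cap A_i\cap B_i$ occurs). Every vertex $v\in[t_i+\kappa_B,t_i+\kappa_C]$, written uniquely as $v=\xi(i,j,k)$ with $j\ge2$, $1\le k\le c_i$, satisfies $\Theta_v=h_M$, $\epsilon_v=\epsilon_{min}$, $X_v=\xi(i,j-1,\max(1,k-1))$, $Y_v=\xi(i,j-1,\min(k+1,c_i))$. **Bottleneck event.** $\mathcal{B}_i:=\{L(t_i)\le b\}\cap A_i\cap B_i\cap C_i$. *)

theory Defs
  imports "HOL-Probability.Probability"
begin

section \<open>Realisations of the graph process\<close>

text \<open>
  A realisation lists, for each vertex \<open>n \<ge> 1\<close>, the values of \<open>\<Theta>\<^sub>n\<close>, \<open>\<epsilon>\<^sub>n\<close>, \<open>X\<^sub>n\<close>, \<open>Y\<^sub>n\<close>;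
  the values at \<open>n = 0\<close> carry no meaning and are never used.  Times are natural numbers
  (\<open>t\<^sub>n = n\<close>).  The convention \<open>G(t\<^sub>n) = G(t\<^sub>0)\<close> for \<open>n < 0\<close> is implemented by truncated
  subtraction: \<open>t\<^sub>n - j\<close> is written \<open>n - j\<close>, which is \<open>0\<close> whenever \<open>n < j\<close>.
\<close>

record realisation =
  pow_time :: "nat \<Rightarrow> nat"
  lag :: "nat \<Rightarrow> nat"
  parent1 :: "nat \<Rightarrow> nat"
  parent2 :: "nat \<Rightarrow> nat"

primrec vertices :: "realisation \<Rightarrow> nat \<Rightarrow> nat set" where
  "vertices g 0 = {0}"
| "vertices g (Suc n) = vertices g n \<union> {k. 1 \<le> k \<and> k + pow_time g k = n}"

primrec edges :: "realisation \<Rightarrow> nat \<Rightarrow> (nat \<times> nat) set" where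
  "edges g 0 = {}"
| "edges g (Suc n) = edges g n
     \<union> {(k, parent1 g k) | k. 1 \<le> k \<and> k + pow_time g k = n}
     \<union> {(k, parent2 g k) | k. 1 \<le> k \<and> k + pow_time g k = n}"

definition tips :: "realisation \<Rightarrow> nat \<Rightarrow> nat set" where
  "tips g n = {v \<in> vertices g n. \<forall>i. (i, v) \<notin> edges g n}"

definition num_tips :: "realisation \<Rightarrow> nat \<Rightarrow> nat" where
  "num_tips g n = card (tips g n)"

definition unfinished :: "realisation \<Rightarrow> nat \<Rightarrow> nat set" where
  "unfinished g n = {i. i < n} - vertices g n"

definition unfinished_edges :: "realisation \<Rightarrow> nat \<Rightarrow> (nat \<times> nat) set" where
  "unfinished_edges g n =
     {(i, parent1 g i) | i. i \<in> unfinished g n} \<union> {(i, parent2 g i) | i. i \<in> unfinished g n}"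

definition pending_tips :: "realisation \<Rightarrow> nat \<Rightarrow> nat set" where
  "pending_tips g n = {i \<in> tips g n. \<exists>j. (j, i) \<in> unfinished_edges g n}"

definition free_tips :: "realisation \<Rightarrow> nat \<Rightarrow> nat set" where
  "free_tips g n = tips g n - pending_tips g n"

definition num_free_tips :: "realisation \<Rightarrow> nat \<Rightarrow> nat" where
  "num_free_tips g n = card (free_tips g n)"

section \<open>The probabilistic model\<close>

definition history :: "'a measure \<Rightarrow> ('a \<Rightarrow> realisation) \<Rightarrow> nat \<Rightarrow> 'a measure" where
  "history P W n = sigma (space P)
     {(\<lambda>\<omega>. f (W \<omega>) m) -` A \<inter> space P | f m A.
        f \<in> {pow_time, lag, parent1, parent2} \<and> 1 \<le> m \<and> m \<le> n}"

locale tangle_model = prob_space P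
  for P :: "'a measure"
    and M :: nat
    and h :: "nat \<Rightarrow> nat"
    and p_pow :: "nat \<Rightarrow> real"
    and I :: "nat set"
    and p_lag :: "nat \<Rightarrow> real"
    and W :: "'a \<Rightarrow> realisation" +
  assumes M_ge_2: "2 \<le> M"
    and h_pos: "0 < h 1"
    and h_increasing: "strict_mono_on {1..M} h"
    and p_pow_pos: "\<And>k. k \<in> {1..M} \<Longrightarrow> 0 < p_pow k"
    and p_pow_sum: "(\<Sum>k\<in>{1..M}. p_pow k) = 1"
    and I_finite: "finite I"
    and I_nonempty: "I \<noteq> {}"
    and I_pos: "\<And>j. j \<in> I \<Longrightarrow> 0 < j"
    and p_lag_pos: "\<And>j. j \<in> I \<Longrightarrow> 0 < p_lag j"
    and p_lag_sum: "(\<Sum>j\<in>I. p_lag j) = 1"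
    and random_variables:
      "\<And>f n. f \<in> {pow_time, lag, parent1, parent2} \<Longrightarrow> 1 \<le> n \<Longrightarrow>
         (\<lambda>\<omega>. f (W \<omega>) n) \<in> measurable P (count_space UNIV)"
    and pow_time_range: "\<And>n \<omega>. 1 \<le> n \<Longrightarrow> \<omega> \<in> space P \<Longrightarrow> pow_time (W \<omega>) n \<in> h ` {1..M}"
    and lag_range: "\<And>n \<omega>. 1 \<le> n \<Longrightarrow> \<omega> \<in> space P \<Longrightarrow> lag (W \<omega>) n \<in> I"
    and law:
      "\<And>n k j v v'. 1 \<le> n \<Longrightarrow> k \<in> {1..M} \<Longrightarrow> j \<in> I \<Longrightarrow>
         AE \<omega> in P.
           real_cond_exp P (history P W (n - 1))
             (indicator {\<omega> \<in> space P. pow_time (W \<omega>) n = h k \<and> lag (W \<omega>) n = j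
                            \<and> parent1 (W \<omega>) n = v \<and> parent2 (W \<omega>) n = v'}) \<omega>
           = p_pow k * p_lag j / (real (num_tips (W \<omega>) (n - j)))\<^sup>2
             * of_bool (v \<in> tips (W \<omega>) (n - j) \<and> v' \<in> tips (W \<omega>) (n - j))"

section \<open>The events\<close>

text \<open>
  Below \<open>hM\<close> is the largest POW duration, \<open>emin\<close> and \<open>emax\<close> are the extreme lags, and
  \<open>kA\<close> stands for \<open>\<kappa>\<^sub>A\<close>.
\<close>

definition event_A :: "nat \<Rightarrow> nat \<Rightarrow> nat \<Rightarrow> realisation \<Rightarrow> nat \<Rightarrow> bool" where
  "event_A hM emin kA g i \<longleftrightarrow>
     (\<forall>j. i \<le> j \<and> j < i + kA \<longrightarrow>
        lag g j = emin \<and> pow_time g j = hM \<and> parent1 g j = parent2 g j \<and>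
        (if \<not> tips g (j - emin) \<subseteq> free_tips g j
         then parent1 g j \<in> tips g (j - emin) - free_tips g j
         else parent1 g j \<in> tips g (j - emin)))"

definition kappa_B :: "nat \<Rightarrow> nat \<Rightarrow> nat" where
  "kappa_B emin kA = kA + emin + 1"

definition kappa_C :: "nat \<Rightarrow> nat \<Rightarrow> nat \<Rightarrow> nat \<Rightarrow> real \<Rightarrow> nat \<Rightarrow> real" where
  "kappa_C M hM emin emax b kA =
     real (kappa_B emin kA) + 2 * (b + real M * real (kappa_B emin kA) + real hM)\<^sup>2
     + real hM + real emax + 1"

definition reserved_tips :: "nat \<Rightarrow> nat \<Rightarrow> nat \<Rightarrow> realisation \<Rightarrow> nat \<Rightarrow> nat set" where
  "reserved_tips hM emin kA g i =
     set (take (2 * (hM + emin)) (sorted_list_of_set (free_tips g (i + kA))))"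

definition event_B :: "nat \<Rightarrow> nat \<Rightarrow> nat \<Rightarrow> realisation \<Rightarrow> nat \<Rightarrow> bool" where
  "event_B hM emin kA g i \<longleftrightarrow>
     (\<forall>j. i + kA \<le> j \<and> j < i + kappa_B emin kA \<longrightarrow>
        pow_time g j = hM \<and> lag g j = emin \<and> parent1 g j = parent2 g j \<and>
        parent1 g j \<in> tips g (j - emin) - reserved_tips hM emin kA g i)"

definition first_layer :: "nat \<Rightarrow> nat \<Rightarrow> realisation \<Rightarrow> nat \<Rightarrow> nat set" where
  "first_layer emin kA g i =
     free_tips g (i + kappa_B emin kA) \<union> unfinished g (i + kappa_B emin kA)"

definition layer_width :: "nat \<Rightarrow> nat \<Rightarrow> realisation \<Rightarrow> nat \<Rightarrow> nat" where
  "layer_width emin kA g i = card (first_layer emin kA g i)"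

text \<open>
  The label \<open>\<xi>(i, j, k)\<close> is meaningful for \<open>j \<ge> 1\<close> and \<open>1 \<le> k \<le> c\<^sub>i\<close>.  The \<open>k\<close>-th smallest
  element has list index \<open>k - 1\<close>, and \<open>\<kappa>\<^sub>B \<ge> 1\<close>, so no subtraction is truncated there.
\<close>

definition xi :: "nat \<Rightarrow> nat \<Rightarrow> realisation \<Rightarrow> nat \<Rightarrow> nat \<Rightarrow> nat \<Rightarrow> nat" where
  "xi emin kA g i j k =
     (if j = 1 then sorted_list_of_set (first_layer emin kA g i) ! (k - 1)
      else i + kappa_B emin kA - 1 + (j - 2) * layer_width emin kA g i + k)"

definition event_C ::
  "nat \<Rightarrow> nat \<Rightarrow> nat \<Rightarrow> nat \<Rightarrow> real \<Rightarrow> nat \<Rightarrow> realisation \<Rightarrow> nat \<Rightarrow> bool" where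
  "event_C M hM emin emax b kA g i \<longleftrightarrow>
     (\<forall>v. i + kappa_B emin kA \<le> v \<and> real v \<le> real i + kappa_C M hM emin emax b kA \<longrightarrow>
        (\<exists>j k. 2 \<le> j \<and> 1 \<le> k \<and> k \<le> layer_width emin kA g i \<and> v = xi emin kA g i j k \<and>
           pow_time g v = hM \<and> lag g v = emin \<and>
           parent1 g v = xi emin kA g i (j - 1) (max 1 (k - 1)) \<and>
           parent2 g v = xi emin kA g i (j - 1) (min (k + 1) (layer_width emin kA g i))))"

definition bottleneck ::
  "nat \<Rightarrow> nat \<Rightarrow> nat \<Rightarrow> nat \<Rightarrow> real \<Rightarrow> nat \<Rightarrow> realisation \<Rightarrow> nat \<Rightarrow> bool" where
  "bottleneck M hM emin emax b kA g i \<longleftrightarrow>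
     real (num_tips g i) \<le> b \<and> event_A hM emin kA g i \<and> event_B hM emin kA g i \<and>
     event_C M hM emin emax b kA g i"

end

theory Submission
  imports Defs
begin

text \<open>
  Let \<open>R(n)\<close> be the number of vertices below \<open>n\<close> that no vertex below \<open>n\<close> has chosen as a parent.
  Then \<open>R(n + 1) = R(n) + 1 - r\<close>, where \<open>r\<close> is the number of such vertices among the parents of \<open>n\<close>.
  All but a bounded number of tips are counted by \<open>R\<close>, so if \<open>L(n) > b\<close> then \<open>r\<close> has conditional
  mean at least \<open>1 + \<eta>\<close> for a fixed \<open>\<eta> > 0\<close>.  As \<open>R \<ge> 0\<close>, this drift forces \<open>L(n) \<le> b\<close>
  infinitely often.  When \<open>L(i) \<le> b\<close>, each of the boundedly many vertices involved in \<open>A\<^sub>i\<close>, \<open>B\<^sub>i\<close>,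
  \<open>C\<^sub>i\<close> has, given the past, an admissible choice among boundedly many tips, so the bottleneck event
  has conditional probability at least some \<open>\<delta> > 0\<close>.  Finally let \<open>D\<^sub>i\<close> be the event that \<open>L(i) \<le> b\<close> and
  no bottleneck has been completed before \<open>i\<close>.  For at most boundedly many \<open>i\<close> a bottleneck starts at
  \<open>i\<close> on \<open>D\<^sub>i\<close>, so the probabilities of the \<open>D\<^sub>i\<close> are summable and almost surely only finitely many
  \<open>D\<^sub>i\<close> occur.
\<close>

section \<open>Vertices, tips and unreferenced vertices\<close>

text \<open>The inequality is strict because a vertex whose work ends at time \<open>n\<close>
  enters the graph only at time \<open>n + 1\<close>.\<close>

lemma vertices_eq: "vertices g n = insert 0 {k. 1 \<le> k \<and> k + pow_time g k < n}"
  by (induction n) auto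

lemma edges_eq:
  "edges g n = {(k, x). 1 \<le> k \<and> k + pow_time g k < n \<and> x \<in> {parent1 g k, parent2 g k}}"
  by (induction n) (auto simp: less_Suc_eq)

lemma in_tips_iff:
  "v \<in> tips g n \<longleftrightarrow> v \<in> vertices g n \<and>
     (\<forall>k. 1 \<le> k \<and> k + pow_time g k < n \<longrightarrow> v \<noteq> parent1 g k \<and> v \<noteq> parent2 g k)"
  by (auto simp: tips_def edges_eq)

lemma unfinished_eq: "unfinished g n = {k. 1 \<le> k \<and> k < n \<and> n \<le> k + pow_time g k}"
  by (auto simp: unfinished_def vertices_eq Suc_le_eq)

lemma finite_vertices [simp]: "finite (vertices g n)"
proof -
  have "vertices g n \<subseteq> insert 0 {..<n}" by (auto simp: vertices_eq)
  then show ?thesis by (rule finite_subset) simp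
qed

lemma finite_tips [simp]: "finite (tips g n)"
  by (rule finite_subset[OF _ finite_vertices]) (auto simp: in_tips_iff)

text \<open>References count from the arrival of the child, not from the end of its work. Along a
  run each step therefore adds one vertex and removes at most two, whereas the set of tips reacts
  with a delay.\<close>

definition unreferenced :: "realisation \<Rightarrow> nat \<Rightarrow> nat set" where
  "unreferenced g n = {v. v < n \<and> (\<forall>k. 1 \<le> k \<and> k < n \<longrightarrow> v \<noteq> parent1 g k \<and> v \<noteq> parent2 g k)}"

lemma finite_unreferenced [simp]: "finite (unreferenced g n)"
  by (rule finite_subset[of _ "{..<n}"]) (auto simp: unreferenced_def)

lemma card_unreferenced_le: "card (unreferenced g n) \<le> n"
  using card_mono[of "{..<n}" "unreferenced g n"] by (auto simp: unreferenced_def)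

text \<open>Being a tip excludes references from finished vertices, and being free excludes those
  from unfinished ones; together these are all vertices below \<open>n\<close>. At
  \<open>n = 0\<close> the equivalence fails: vertex 0 is a free tip but is not below
  \<open>n\<close>.\<close>

lemma in_free_tips_iff:
  assumes "1 \<le> n"
  shows "v \<in> free_tips g n \<longleftrightarrow> v \<in> vertices g n \<and> v \<in> unreferenced g n"
proof -
  have v: "v < n" if "v \<in> vertices g n" using that assms by (auto simp: vertices_eq)
  have "v \<in> free_tips g n \<longleftrightarrow> v \<in> vertices g n \<and>
      (\<forall>k. 1 \<le> k \<and> k + pow_time g k < n \<longrightarrow> v \<noteq> parent1 g k \<and> v \<noteq> parent2 g k) \<and>
      (\<forall>k. 1 \<le> k \<and> k < n \<and> n \<le> k + pow_time g k \<longrightarrow> v \<noteq> parent1 g k \<and> v \<noteq> parent2 g k)"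
    unfolding free_tips_def pending_tips_def unfinished_edges_def unfinished_eq Diff_iff in_tips_iff
      mem_Collect_eq Un_iff prod.inject by metis
  also have "\<dots> \<longleftrightarrow> v \<in> vertices g n \<and> (\<forall>k. 1 \<le> k \<and> k < n \<longrightarrow> v \<noteq> parent1 g k \<and> v \<noteq> parent2 g k)"
    using add_lessD1 not_less by blast
  finally show ?thesis using v by (auto simp: unreferenced_def)
qed

section \<open>Functions of finitely many arrivals\<close>

definition agree :: "nat \<Rightarrow> realisation \<Rightarrow> realisation \<Rightarrow> bool" where
  "agree n g g' \<longleftrightarrow> (\<forall>m. 1 \<le> m \<and> m \<le> n \<longrightarrow> pow_time g m = pow_time g' m \<and> lag g m = lag g' m \<and>
     parent1 g m = parent1 g' m \<and> parent2 g m = parent2 g' m)"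

text \<open>A pathwise substitute for measurability with respect to the past: real and boolean
  functions of this kind are later shown to be measurable for \<open>history P W n\<close>.\<close>

definition determined :: "nat \<Rightarrow> (realisation \<Rightarrow> 'b) \<Rightarrow> bool" where
  "determined n f \<longleftrightarrow> (\<forall>g g'. agree n g g' \<longrightarrow> f g = f g')"

lemma determinedD: "determined n f \<Longrightarrow> agree n g g' \<Longrightarrow> f g = f g'"
  by (auto simp: determined_def)

lemma agree_mono: "agree n g g' \<Longrightarrow> m \<le> n \<Longrightarrow> agree m g g'"
  by (auto simp: agree_def)

text \<open>A vertex other than 0 that is visible at time \<open>m\<close> arrived before
  \<open>m\<close>, so the arrivals up to \<open>n\<close> fix the graph even at time
  \<open>Suc n\<close>.\<close>

lemma agree_vertices: "agree n g g' \<Longrightarrow> m \<le> Suc n \<Longrightarrow> vertices g m = vertices g' m"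
  by (auto simp: agree_def vertices_eq)

lemma agree_at:
  assumes "agree n g g'" "1 \<le> k" "k \<le> n"
  shows "pow_time g k = pow_time g' k" "lag g k = lag g' k"
    "parent1 g k = parent1 g' k" "parent2 g k = parent2 g' k"
  using assms by (auto simp: agree_def)

lemma agree_tips:
  assumes "agree n g g'" "m \<le> Suc n"
  shows "tips g m = tips g' m"
proof -
  have "(1 \<le> k \<and> k + pow_time g k < m \<longrightarrow> v \<noteq> parent1 g k \<and> v \<noteq> parent2 g k) \<longleftrightarrow>
        (1 \<le> k \<and> k + pow_time g' k < m \<longrightarrow> v \<noteq> parent1 g' k \<and> v \<noteq> parent2 g' k)" for k v
  proof (cases "1 \<le> k \<and> k \<le> n")
    case True
    then show ?thesis using agree_at[OF assms(1), of k] by simp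
  next
    case False
    then show ?thesis using assms(2) by auto
  qed
  then show ?thesis
    unfolding set_eq_iff in_tips_iff agree_vertices[OF assms] by presburger
qed

lemma agree_unfinished:
  assumes "agree n g g'" "m \<le> Suc n"
  shows "unfinished g m = unfinished g' m"
  by (simp add: unfinished_def agree_vertices[OF assms])

lemma agree_unreferenced:
  assumes "agree n g g'" "m \<le> Suc n"
  shows "unreferenced g m = unreferenced g' m"
proof -
  have "(1 \<le> k \<and> k < m \<longrightarrow> v \<noteq> parent1 g k \<and> v \<noteq> parent2 g k) \<longleftrightarrow>
        (1 \<le> k \<and> k < m \<longrightarrow> v \<noteq> parent1 g' k \<and> v \<noteq> parent2 g' k)" for k v
  proof (cases "1 \<le> k \<and> k \<le> n")
    case True
    then show ?thesis using agree_at[OF assms(1), of k] by simp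
  next
    case False
    then show ?thesis using assms(2) by auto
  qed
  then show ?thesis unfolding unreferenced_def by presburger
qed

lemma agree_free_tips:
  assumes "agree n g g'" "m \<le> Suc n"
  shows "free_tips g m = free_tips g' m"
proof (cases m)
  case 0
  then show ?thesis
    using agree_tips[OF assms]
    by (simp add: free_tips_def pending_tips_def unfinished_edges_def unfinished_def)
next
  case (Suc k)
  then have "1 \<le> m" by simp
  then show ?thesis
    unfolding set_eq_iff in_free_tips_iff[OF \<open>1 \<le> m\<close>] agree_vertices[OF assms]
      agree_unreferenced[OF assms] by simp
qed

text \<open>The \<open>q\<close>-th smallest element and the \<open>card S - q\<close> larger ones
  are distinct and lie below \<open>n\<close>, so there must be room for all of them between that
  element and \<open>n\<close>.\<close>

lemma sorted_list_of_set_nth_less: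
  assumes fin: "S \<subseteq> {..<n::nat}" and q: "1 \<le> q" "q \<le> card S"
  shows "sorted_list_of_set S ! (q - 1) + card S < n + q"
proof -
  let ?l = "sorted_list_of_set S"
  have S: "finite S" using fin by (rule finite_subset) simp
  have len: "length ?l = card S" and set: "set ?l = S" using S by auto
  have sorted: "sorted ?l" "distinct ?l" by auto
  have "set (drop (q - 1) ?l) \<subseteq> {?l ! (q - 1)..<n}"
  proof
    fix x assume "x \<in> set (drop (q - 1) ?l)"
    then obtain r where r: "r < card S - (q - 1)" "x = ?l ! (q - 1 + r)"
      by (auto simp: in_set_conv_nth len)
    then have "?l ! (q - 1) \<le> x" using sorted(1) len q by (auto intro!: sorted_nth_mono)
    moreover have "x \<in> S" using r q len set by (metis nth_mem less_diff_conv add.commute)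
    ultimately show "x \<in> {?l ! (q - 1)..<n}" using fin by auto
  qed
  then have "card (set (drop (q - 1) ?l)) \<le> n - ?l ! (q - 1)"
    by (metis card_mono card_atLeastLessThan finite_atLeastLessThan)
  moreover have "card (set (drop (q - 1) ?l)) = card S - (q - 1)"
    using sorted(2) len by (simp add: distinct_card)
  ultimately show ?thesis using q by linarith
qed

section \<open>Deterministic bounds along a single run\<close>

text \<open>Collects properties that almost every realisation of the model has, so that the
  combinatorics can be done without probability.\<close>

locale tangle_run =
  fixes g :: realisation and h1 hM emin :: nat
  assumes h1_pos: "1 \<le> h1" and emin_pos: "1 \<le> emin"
    and hM_ge_2: "2 \<le> hM"
    and pow_ge: "1 \<le> n \<Longrightarrow> h1 \<le> pow_time g n" and pow_le: "1 \<le> n \<Longrightarrow> pow_time g n \<le> hM"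
    and parent1_tip: "1 \<le> n \<Longrightarrow> parent1 g n \<in> tips g (n - lag g n)"
    and parent2_tip: "1 \<le> n \<Longrightarrow> parent2 g n \<in> tips g (n - lag g n)"
begin

lemma h1_le_hM: "h1 \<le> hM"
  using pow_ge[of 1] pow_le[of 1] by simp

lemma parents_in_vertices:
  assumes "1 \<le> n"
  shows "parent1 g n \<in> vertices g n" "parent2 g n \<in> vertices g n"
  using parent1_tip[OF assms] parent2_tip[OF assms] by (auto simp: in_tips_iff vertices_eq)

lemma vertices_less: "v \<in> vertices g n \<Longrightarrow> 1 \<le> n \<Longrightarrow> v < n"
  by (auto simp: vertices_eq)

lemma parents_less:
  assumes "1 \<le> n" shows "parent1 g n < n" "parent2 g n < n"
  using parents_in_vertices[OF assms] assms by (auto intro: vertices_less)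

text \<open>Parents are older than their children, so the youngest visible vertex has no visible
  child.\<close>

lemma tips_nonempty: "tips g n \<noteq> {}"
proof -
  let ?m = "Max (vertices g n)"
  have V: "vertices g n \<noteq> {}" by (auto simp: vertices_eq)
  have "?m \<in> tips g n"
    unfolding in_tips_iff
  proof (intro conjI allI impI)
    show "?m \<in> vertices g n" using V by simp
  next
    fix k assume k: "1 \<le> k \<and> k + pow_time g k < n"
    then have "k \<in> vertices g n" by (simp add: vertices_eq)
    then have "k \<le> ?m" by simp
    with parents_less[of k] k show "?m \<noteq> parent1 g k" "?m \<noteq> parent2 g k" by auto
  qed
  then show ?thesis by blast
qed

lemma num_tips_pos: "0 < num_tips g n"
  using tips_nonempty by (simp add: num_tips_def card_gt_0_iff)

text \<open>Vertex \<open>n\<close> enters, since nobody refers to it yet, and those of its parents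
  that were unreferenced leave. Equal parents form a one-element set and are counted once.\<close>

lemma card_unreferenced_Suc:
  assumes "1 \<le> n"
  shows "card (unreferenced g (Suc n)) + card ({parent1 g n, parent2 g n} \<inter> unreferenced g n)
    = card (unreferenced g n) + 1"
proof -
  have less: "parent1 g k \<noteq> n \<and> parent2 g k \<noteq> n" if "1 \<le> k" "k \<le> n" for k
    using parents_less[OF that(1)] that(2) by auto
  have "x \<in> unreferenced g (Suc n) \<longleftrightarrow> x = n \<or> x \<in> unreferenced g n - {parent1 g n, parent2 g n}" for x
  proof (cases "x = n")
    case True
    then show ?thesis using less by (fastforce simp: unreferenced_def less_Suc_eq_le)
  next
    case False
    have "(\<forall>k. 1 \<le> k \<and> k < Suc n \<longrightarrow> Q k) \<longleftrightarrow> (\<forall>k. 1 \<le> k \<and> k < n \<longrightarrow> Q k) \<and> Q n" for Q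
      using assms less_Suc_eq by auto
    from False this[of "\<lambda>k. x \<noteq> parent1 g k \<and> x \<noteq> parent2 g k"] show ?thesis
      by (auto simp: unreferenced_def less_Suc_eq)
  qed
  then have *: "unreferenced g (Suc n) = insert n (unreferenced g n - {parent1 g n, parent2 g n})"
    by blast
  have "n \<notin> unreferenced g n" by (simp add: unreferenced_def)
  then have "card (unreferenced g (Suc n)) = Suc (card (unreferenced g n - {parent1 g n, parent2 g n}))"
    unfolding * by simp
  also have "card (unreferenced g n - {parent1 g n, parent2 g n})
      = card (unreferenced g n) - card (unreferenced g n \<inter> {parent1 g n, parent2 g n})"
    by (rule card_Diff_subset_Int) simp
  finally show ?thesis
    using card_mono[of "unreferenced g n" "unreferenced g n \<inter> {parent1 g n, parent2 g n}"]
    by (simp add: Int_commute)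
qed

lemma card_unreferenced_Suc_bounds:
  assumes "1 \<le> n"
  shows "card (unreferenced g (Suc n)) \<le> card (unreferenced g n) + 1"
    and "card (unreferenced g n) \<le> card (unreferenced g (Suc n)) + 1"
proof -
  have "card ({parent1 g n, parent2 g n} \<inter> unreferenced g n) \<le> card {parent1 g n, parent2 g n}"
    by (rule card_mono) auto
  also have "\<dots> \<le> 2" by (simp add: card_insert_if)
  finally show "card (unreferenced g (Suc n)) \<le> card (unreferenced g n) + 1"
    "card (unreferenced g n) \<le> card (unreferenced g (Suc n)) + 1"
    using card_unreferenced_Suc[OF assms] by linarith+
qed

lemma card_unreferenced_add:
  assumes "1 \<le> n"
  shows "card (unreferenced g (n + k)) \<le> card (unreferenced g n) + k \<and>
    card (unreferenced g n) \<le> card (unreferenced g (n + k)) + k"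
proof (induction k)
  case (Suc k)
  then show ?case using card_unreferenced_Suc_bounds[of "n + k"] assms by simp
qed simp

lemma card_unfinished_le: "card (unfinished g n) \<le> hM"
proof -
  have "unfinished g n \<subseteq> {n - hM..<n}"
  proof
    fix k assume "k \<in> unfinished g n"
    then have "1 \<le> k" "k < n" "n \<le> k + pow_time g k" by (auto simp: unfinished_eq)
    with pow_le[of k] show "k \<in> {n - hM..<n}" by auto
  qed
  then have "card (unfinished g n) \<le> card {n - hM..<n}" by (intro card_mono) auto
  then show ?thesis by simp
qed

text \<open>Parents are visible when they are chosen, and visible vertices stay visible; hence a
  vertex still unfinished at time \<open>n\<close> was never chosen by a vertex below
  \<open>n\<close>.\<close>

lemma unreferenced_eq:
  assumes "1 \<le> n"
  shows "unreferenced g n = free_tips g n \<union> unfinished g n"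
proof -
  have "x \<in> unreferenced g n" if x: "x \<in> unfinished g n" for x
  proof -
    have "x < n" "x \<notin> vertices g n" using x by (auto simp: unfinished_def)
    moreover have "x \<noteq> parent1 g k \<and> x \<noteq> parent2 g k" if "1 \<le> k" "k < n" for k
    proof -
      have "vertices g k \<subseteq> vertices g n" using that by (auto simp: vertices_eq)
      then show ?thesis using parents_in_vertices[OF that(1)] \<open>x \<notin> vertices g n\<close> by auto
    qed
    ultimately show ?thesis by (simp add: unreferenced_def)
  qed
  moreover have "x \<in> unfinished g n" if "x \<in> unreferenced g n" "x \<notin> vertices g n" for x
    using that by (simp add: unfinished_def unreferenced_def)
  ultimately show ?thesis using in_free_tips_iff[OF assms] by blast
qed

text \<open>A tip that is not free is a parent of one of the at most \<open>hM\<close> unfinished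
  vertices, each of which has two parents.\<close>

lemma num_tips_le_unreferenced:
  assumes "1 \<le> n"
  shows "num_tips g n \<le> card (unreferenced g n) + 2 * hM"
proof -
  have "tips g n \<subseteq> free_tips g n \<union> (parent1 g ` unfinished g n \<union> parent2 g ` unfinished g n)"
    by (auto simp: free_tips_def pending_tips_def unfinished_edges_def)
  also have "\<dots> \<subseteq> unreferenced g n \<union> (parent1 g ` unfinished g n \<union> parent2 g ` unfinished g n)"
    using unreferenced_eq[OF assms] by blast
  finally have "tips g n \<subseteq> unreferenced g n \<union> (parent1 g ` unfinished g n \<union> parent2 g ` unfinished g n)" .
  then have "num_tips g n \<le> card (unreferenced g n \<union> (parent1 g ` unfinished g n \<union> parent2 g ` unfinished g n))"
    unfolding num_tips_def by (intro card_mono) (auto simp: unfinished_def)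
  also have "\<dots> \<le> card (unreferenced g n) + (card (parent1 g ` unfinished g n) + card (parent2 g ` unfinished g n))"
    by (meson card_Un_le add_left_mono order_trans)
  also have "\<dots> \<le> card (unreferenced g n) + (card (unfinished g n) + card (unfinished g n))"
    by (intro add_mono card_image_le) (auto simp: unfinished_def)
  finally show ?thesis using card_unfinished_le[of n] by simp
qed

lemma unreferenced_le_num_tips:
  assumes "1 \<le> n"
  shows "card (unreferenced g n) \<le> num_tips g n + hM"
proof -
  have "card (unreferenced g n) \<le> card (free_tips g n) + card (unfinished g n)"
    unfolding unreferenced_eq[OF assms] by (rule card_Un_le)
  also have "card (free_tips g n) \<le> num_tips g n"
    unfolding num_tips_def free_tips_def by (intro card_mono) auto
  finally show ?thesis using card_unfinished_le[of n] by simp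
qed

lemma num_tips_0: "num_tips g 0 = 1"
  by (simp add: num_tips_def tips_def)

text \<open>The comparison passes through the number of unreferenced vertices, which moves by at
  most one per time step. Passing between tips and unreferenced vertices costs \<open>hM\<close> at
  time \<open>i\<close> and \<open>2 * hM\<close> at time \<open>m - e\<close>.\<close>

lemma num_tips_bound:
  assumes "1 \<le> i" "i \<le> m"
  shows "num_tips g (m - e) \<le> num_tips g i + 3 * hM + (m - i) + e + 1"
\<comment> \<open>Time 0 is separate because the comparison with unreferenced vertices starts at
  time 1.\<close>
proof (cases "m - e = 0")
  case True
  then show ?thesis by (simp add: num_tips_0)
next
  case False
  then have 1: "1 \<le> m - e" by simp
  have "card (unreferenced g (m - e)) \<le> card (unreferenced g i) + (m - i) + e"
  proof (cases "i \<le> m - e")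
    case True
    then have "i + (m - e - i) = m - e" by simp
    then show ?thesis using card_unreferenced_add[OF assms(1), of "m - e - i"] True by (simp; linarith)
  next
    case F: False
    then have "m - e + (i - (m - e)) = i" by simp
    then show ?thesis using card_unreferenced_add[OF 1, of "i - (m - e)"] F assms by (simp; linarith)
  qed
  then show ?thesis
    using num_tips_le_unreferenced[OF 1] unreferenced_le_num_tips[OF assms(1)] by linarith
qed

text \<open>A vertex below \<open>n\<close> that refers to a tip of time \<open>n - j\<close> had
  not entered the graph by time \<open>n - j\<close>, so it arrived at time
  \<open>n - j - hM\<close> or later. There are at most \<open>hM + j\<close> such vertices, with
  two parents each.\<close>

lemma card_tips_diff_unreferenced:
  assumes "1 \<le> n"
  shows "card (tips g (n - j) - unreferenced g n) \<le> 2 * (hM + j)"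
proof -
  let ?S = "{k. 1 \<le> k \<and> n - j - hM \<le> k \<and> k < n}"
  have sub: "?S \<subseteq> {n - j - hM..<n}" by auto
  then have fin: "finite ?S" by (rule finite_subset) simp
  have cS: "card ?S \<le> hM + j" using card_mono[OF _ sub] by simp
  have "tips g (n - j) - unreferenced g n \<subseteq> parent1 g ` ?S \<union> parent2 g ` ?S"
  proof
    fix v assume v: "v \<in> tips g (n - j) - unreferenced g n"
    then have "v < n" using assms by (auto simp: in_tips_iff vertices_eq)
    with v obtain k where k: "1 \<le> k" "k < n" "v = parent1 g k \<or> v = parent2 g k"
      by (auto simp: unreferenced_def)
    then have "\<not> k + pow_time g k < n - j" using v by (auto simp: in_tips_iff)
    then have "n - j - hM \<le> k" using pow_le[OF k(1)] by linarith
    then show "v \<in> parent1 g ` ?S \<union> parent2 g ` ?S" using k by auto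
  qed
  then have "card (tips g (n - j) - unreferenced g n) \<le> card (parent1 g ` ?S \<union> parent2 g ` ?S)"
    using fin by (intro card_mono) auto
  also have "\<dots> \<le> card (parent1 g ` ?S) + card (parent2 g ` ?S)" by (rule card_Un_le)
  also have "\<dots> \<le> card ?S + card ?S" by (intro add_mono card_image_le fin)
  finally show ?thesis using cS by simp
qed

text \<open>A tip at time \<open>n\<close> that was visible at time \<open>n - j\<close> was a tip
  already then. Any other tip became visible in between, which confines its label to a window of
  length at most \<open>hM - h1 + j\<close>.\<close>

lemma num_tips_le_earlier: "num_tips g n \<le> num_tips g (n - j) + (hM - h1 + j)"
proof (cases "h1 < n")
  case True
  have "tips g n \<subseteq> tips g (n - j) \<union> {n - j - hM..<n - h1}"
  proof
    fix v assume v: "v \<in> tips g n"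
    show "v \<in> tips g (n - j) \<union> {n - j - hM..<n - h1}"
    proof (cases "v \<in> vertices g (n - j)")
      case True
      then show ?thesis using v by (auto simp: in_tips_iff)
    next
      case False
      then have "1 \<le> v" "v + pow_time g v < n" "n - j \<le> v + pow_time g v"
        using v by (auto simp: in_tips_iff vertices_eq)
      then show ?thesis using pow_ge[of v] pow_le[of v] by auto
    qed
  qed
  then have "card (tips g n) \<le> card (tips g (n - j) \<union> {n - j - hM..<n - h1})"
    by (intro card_mono) auto
  also have "\<dots> \<le> card (tips g (n - j)) + card {n - j - hM..<n - h1}" by (rule card_Un_le)
  finally show ?thesis using h1_le_hM True by (simp add: num_tips_def)
next
  \<comment> \<open>Up to time \<open>h1\<close> no vertex other than 0 is visible.\<close>
  case False
  have "tips g n \<subseteq> {0}"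
  proof
    fix v assume "v \<in> tips g n"
    then have "v = 0 \<or> 1 \<le> v \<and> v + pow_time g v < n" by (auto simp: in_tips_iff vertices_eq)
    then show "v \<in> {0}" using pow_ge[of v] False by auto
  qed
  then have "num_tips g n \<le> card {0::nat}" unfolding num_tips_def by (intro card_mono) auto
  then show ?thesis using num_tips_pos[of "n - j"] by simp
qed

end

section \<open>Admissible choices of parents\<close>

text \<open>Merges what the three events demand of the parents of vertex \<open>m\<close>. The
  candidates \<open>v\<close>, \<open>v'\<close> are arguments rather than read off
  \<open>g\<close>, so that the condition depends only on arrivals before \<open>m\<close> and can
  be summed over all choices.\<close>

definition allowed_parents ::
  "nat \<Rightarrow> nat \<Rightarrow> nat \<Rightarrow> realisation \<Rightarrow> nat \<Rightarrow> nat \<Rightarrow> nat \<Rightarrow> nat \<Rightarrow> bool" where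
  "allowed_parents hM emin kA g i m v v' \<longleftrightarrow>
    (if m < i + kA then
       v = v' \<and> (if \<not> tips g (m - emin) \<subseteq> free_tips g m then v \<in> tips g (m - emin) - free_tips g m
                 else v \<in> tips g (m - emin))
     else if m < i + kappa_B emin kA then
       v = v' \<and> v \<in> tips g (m - emin) - reserved_tips hM emin kA g i
     else (\<exists>j k. 2 \<le> j \<and> 1 \<le> k \<and> k \<le> layer_width emin kA g i \<and> m = xi emin kA g i j k \<and>
             v = xi emin kA g i (j - 1) (max 1 (k - 1)) \<and>
             v' = xi emin kA g i (j - 1) (min (k + 1) (layer_width emin kA g i))))"

text \<open>Turns a bottleneck into a chain of one-step conditions, so that its probability can be
  bounded one arrival at a time. The end point \<open>n\<close> is excluded.\<close>

definition stage :: "nat \<Rightarrow> nat \<Rightarrow> nat \<Rightarrow> realisation \<Rightarrow> nat \<Rightarrow> nat \<Rightarrow> bool" where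
  "stage hM emin kA g i n \<longleftrightarrow>
    (\<forall>m. i \<le> m \<and> m < n \<longrightarrow> pow_time g m = hM \<and> lag g m = emin \<and>
       allowed_parents hM emin kA g i m (parent1 g m) (parent2 g m))"

lemma stage_Suc:
  "i \<le> n \<Longrightarrow> stage hM emin kA g i (Suc n) \<longleftrightarrow> stage hM emin kA g i n \<and>
     pow_time g n = hM \<and> lag g n = emin \<and>
     allowed_parents hM emin kA g i n (parent1 g n) (parent2 g n)"
  by (auto simp: stage_def less_Suc_eq)

lemma stage_refl [simp]: "stage hM emin kA g i i"
  by (auto simp: stage_def)

lemma stage_event_A: "stage hM emin kA g i n \<Longrightarrow> i + kA \<le> n \<Longrightarrow> event_A hM emin kA g i"
  unfolding event_A_def
proof (intro allI impI)
  fix j assume *: "stage hM emin kA g i n" "i + kA \<le> n" "i \<le> j \<and> j < i + kA"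
  then have "pow_time g j = hM \<and> lag g j = emin \<and>
       allowed_parents hM emin kA g i j (parent1 g j) (parent2 g j)"
    by (auto simp: stage_def)
  then show "lag g j = emin \<and> pow_time g j = hM \<and> parent1 g j = parent2 g j \<and>
        (if \<not> tips g (j - emin) \<subseteq> free_tips g j
         then parent1 g j \<in> tips g (j - emin) - free_tips g j
         else parent1 g j \<in> tips g (j - emin))"
    using * by (auto simp: allowed_parents_def split: if_splits)
qed

lemma stage_event_B:
  "stage hM emin kA g i n \<Longrightarrow> i + kappa_B emin kA \<le> n \<Longrightarrow> event_B hM emin kA g i"
  unfolding event_B_def
proof (intro allI impI)
  fix j assume *: "stage hM emin kA g i n" "i + kappa_B emin kA \<le> n"
    "i + kA \<le> j \<and> j < i + kappa_B emin kA"
  then have "pow_time g j = hM \<and> lag g j = emin \<and>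
       allowed_parents hM emin kA g i j (parent1 g j) (parent2 g j)"
    by (auto simp: stage_def)
  then show "pow_time g j = hM \<and> lag g j = emin \<and> parent1 g j = parent2 g j \<and>
        parent1 g j \<in> tips g (j - emin) - reserved_tips hM emin kA g i"
    using * by (auto simp: allowed_parents_def)
qed

text \<open>\<open>kappa_C\<close> is a real number and the window of the event is closed; the
  second hypothesis ensures that every integer in the window is at most
  \<open>i + K\<close>.\<close>

lemma stage_event_C:
  assumes "stage hM emin kA g i (Suc (i + K))" "kappa_C M hM emin emax b kA < real K + 1"
  shows "event_C M hM emin emax b kA g i"
  unfolding event_C_def
proof (intro allI impI)
  fix v assume v: "i + kappa_B emin kA \<le> v \<and> real v \<le> real i + kappa_C M hM emin emax b kA"
  then have "v \<le> i + K" using assms(2) by linarith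
  then have "pow_time g v = hM \<and> lag g v = emin \<and>
       allowed_parents hM emin kA g i v (parent1 g v) (parent2 g v)"
    using assms(1) v by (auto simp: stage_def)
  then show "\<exists>j k. 2 \<le> j \<and> 1 \<le> k \<and> k \<le> layer_width emin kA g i \<and> v = xi emin kA g i j k \<and>
           pow_time g v = hM \<and> lag g v = emin \<and>
           parent1 g v = xi emin kA g i (j - 1) (max 1 (k - 1)) \<and>
           parent2 g v = xi emin kA g i (j - 1) (min (k + 1) (layer_width emin kA g i))"
    using v unfolding allowed_parents_def by (auto simp: kappa_B_def)
qed

lemma card_reserved_tips_le: "card (reserved_tips hM emin kA g i) \<le> 2 * (hM + emin)"
  unfolding reserved_tips_def by (rule order_trans[OF card_length]) simp

section \<open>Existence of admissible parents in each phase\<close>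

context tangle_run
begin

text \<open>From time \<open>i + hM\<close> on, all vertices older than \<open>i\<close> have
  finished because \<open>hM\<close> is the longest duration, and the vertices from \<open>i\<close>
  on take exactly \<open>hM\<close>. Visibility is then a matter of the label alone.\<close>

lemma vertices_stage:
  assumes st: "stage hM emin kA g i m" and i: "1 \<le> i" and s: "i + hM \<le> s" "s \<le> m"
  shows "vertices g s = {k. k + hM < s}"
proof -
  have "x \<in> vertices g s \<longleftrightarrow> x + hM < s" for x
  proof (cases "x = 0")
    case True
    then show ?thesis using i s by (simp add: vertices_eq)
  next
    case x: False
    show ?thesis
    proof (cases "i \<le> x \<and> x < m")
      case True
      then have "pow_time g x = hM" using st by (simp add: stage_def)
      then show ?thesis using x by (simp add: vertices_eq)
    next
      case False
      then show ?thesis using x s pow_le[of x] by (auto simp: vertices_eq)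
    qed
  qed
  then show ?thesis by auto
qed

lemma allowed_parents_A:
  assumes "m < i + kA"
  shows "\<exists>v\<in>tips g (m - emin). \<exists>v'\<in>tips g (m - emin). allowed_parents hM emin kA g i m v v'"
proof (cases "tips g (m - emin) \<subseteq> free_tips g m")
  case True
  then show ?thesis using tips_nonempty[of "m - emin"] assms by (auto simp: allowed_parents_def)
next
  case False
  then obtain v where "v \<in> tips g (m - emin)" "v \<notin> free_tips g m" by auto
  then show ?thesis using assms False by (auto simp: allowed_parents_def)
qed

text \<open>Of the more than \<open>3 * (hM + emin)\<close> free tips at time \<open>i + kA\<close>,
  at most \<open>2 * (hM + emin)\<close> are reserved, and at most \<open>hM + emin\<close> became
  visible only after time \<open>m - emin\<close>. Any other one was visible at time
  \<open>m - emin\<close> and, having no references, was a tip then.\<close>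

lemma allowed_parents_B:
  assumes st: "stage hM emin kA g i m" and i: "1 \<le> i"
    and m: "i + kA \<le> m" "m < i + kappa_B emin kA"
    and kA: "hM + emin \<le> kA"
    and free: "3 * (hM + emin) < num_free_tips g (i + kA)"
  shows "\<exists>v\<in>tips g (m - emin). \<exists>v'\<in>tips g (m - emin). allowed_parents hM emin kA g i m v v'"
proof -
  let ?s = "m - emin" and ?t = "i + kA"
  have t: "1 \<le> ?t" using i by simp
  have s: "i + hM \<le> ?s" "?s \<le> ?t" using m kA by (auto simp: kappa_B_def)
  have Vs: "vertices g ?s = {k. k + hM < ?s}"
    by (rule vertices_stage[OF st i s(1)]) simp
  have Vt: "vertices g ?t = {k. k + hM < ?t}"
    by (rule vertices_stage[OF st i]) (use kA m in auto)
  have "card (reserved_tips hM emin kA g i \<union> {?s - hM..<?t - hM})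
      \<le> card (reserved_tips hM emin kA g i) + card {?s - hM..<?t - hM}"
    by (rule card_Un_le)
  also have "\<dots> \<le> 2 * (hM + emin) + (emin + hM)"
    using card_reserved_tips_le[of hM emin kA g i] m by simp
  also have "\<dots> < card (free_tips g ?t)"
    using free by (simp add: num_free_tips_def)
  finally have "card (reserved_tips hM emin kA g i \<union> {?s - hM..<?t - hM}) < card (free_tips g ?t)" .
  then have "\<not> free_tips g ?t \<subseteq> reserved_tips hM emin kA g i \<union> {?s - hM..<?t - hM}"
    using card_mono[of "reserved_tips hM emin kA g i \<union> {?s - hM..<?t - hM}" "free_tips g ?t"]
    by (auto simp: reserved_tips_def)
  then obtain v where v: "v \<in> free_tips g ?t" "v \<notin> reserved_tips hM emin kA g i"
    "v \<notin> {?s - hM..<?t - hM}" by blast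
  then have "v \<in> vertices g ?t" "v \<in> unreferenced g ?t" by (auto simp: in_free_tips_iff[OF t])
  then have "v + hM < ?t" unfolding Vt by simp
  then have "v + hM < ?s" using v(3) by auto
  then have "v \<in> tips g ?s"
    using \<open>v \<in> unreferenced g ?t\<close> Vs s(2) by (auto simp: in_tips_iff unreferenced_def)
  then show ?thesis using v(2) m by (auto simp: allowed_parents_def)
qed

text \<open>Layers from the second on are consecutive blocks of length \<open>layer_width\<close>.
  The first layer consists of that many numbers below \<open>i + kappa_B\<close>, so its
  \<open>q\<close>-th element is at most the \<open>q\<close>-th element of the block ending just
  before \<open>i + kappa_B\<close>. Hence equal positions in successive layers are at least one
  layer width apart.\<close>

lemma xi_layer_less:
  assumes i: "1 \<le> i" and j: "1 \<le> j" and q: "1 \<le> q" "q \<le> layer_width emin kA g i"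
  shows "xi emin kA g i j q + layer_width emin kA g i
    < i + kappa_B emin kA + (j - 1) * layer_width emin kA g i + q"
    (is "?x + ?c < _")
proof (cases "j = 1")
  case True
  have n: "1 \<le> i + kappa_B emin kA" using i by simp
  have "first_layer emin kA g i \<subseteq> {..<i + kappa_B emin kA}"
    using unreferenced_eq[OF n] unfolding first_layer_def by (auto simp: unreferenced_def)
  from sorted_list_of_set_nth_less[OF this] q show ?thesis
    using True by (simp add: xi_def layer_width_def)
next
  case False
  then obtain j' where "j = Suc (Suc j')" using j by (metis One_nat_def Suc_le_D nat.exhaust not_less_eq_eq)
  then show ?thesis using i by (simp add: xi_def kappa_B_def)
qed

text \<open>Free tips together with unfinished vertices are exactly the unreferenced
  vertices.\<close>

lemma xi_first_layer:
  assumes i: "1 \<le> i" and q: "1 \<le> q" "q \<le> layer_width emin kA g i"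
  shows "xi emin kA g i 1 q \<in> unreferenced g (i + kappa_B emin kA)"
proof -
  have n: "1 \<le> i + kappa_B emin kA" using i by simp
  have f: "first_layer emin kA g i = unreferenced g (i + kappa_B emin kA)"
    using unreferenced_eq[OF n] by (simp add: first_layer_def)
  have "sorted_list_of_set (unreferenced g (i + kappa_B emin kA)) ! (q - 1)
      \<in> set (sorted_list_of_set (unreferenced g (i + kappa_B emin kA)))"
    by (rule nth_mem) (use q in \<open>simp add: f layer_width_def\<close>)
  then show ?thesis by (simp add: xi_def f)
qed

text \<open>The first layer lies below \<open>i + kappa_B\<close> and the others at or above it.
  Within the latter, layer and position are quotient and remainder modulo the layer width.\<close>

lemma xi_inj:
  assumes i: "1 \<le> i" and eq: "xi emin kA g i j q = xi emin kA g i j' q'"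
    and j: "1 \<le> j" "1 \<le> j'"
    and q: "1 \<le> q" "q \<le> layer_width emin kA g i" "1 \<le> q'" "q' \<le> layer_width emin kA g i"
  shows "j = j' \<and> q = q'"
proof -
  let ?n = "i + kappa_B emin kA" and ?c = "layer_width emin kA g i"
  have first: "xi emin kA g i 1 r < ?n" if "1 \<le> r" "r \<le> ?c" for r
    using xi_first_layer[OF i that] by (simp add: unreferenced_def)
  have later: "?n \<le> xi emin kA g i l r" if "2 \<le> l" "1 \<le> r" for l r
    using that i by (simp add: xi_def kappa_B_def)
  have "j = 1 \<longleftrightarrow> j' = 1"
    using first[OF q(1,2)] first[OF q(3,4)] later[OF _ q(1), of j] later[OF _ q(3), of j'] eq j
    by (cases "j = 1"; cases "j' = 1") auto
  show ?thesis
  proof (cases "j = 1")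
    case True
    then have "j' = 1" using \<open>j = 1 \<longleftrightarrow> j' = 1\<close> by simp
    have "q - 1 = q' - 1"
      using eq True \<open>j' = 1\<close> q nth_eq_iff_index_eq[of "sorted_list_of_set (first_layer emin kA g i)" "q - 1" "q' - 1"]
      by (auto simp: xi_def layer_width_def)
    then show ?thesis using True \<open>j' = 1\<close> q by simp
  next
    case False
    then have j2: "2 \<le> j" "2 \<le> j'"
      using \<open>j = 1 \<longleftrightarrow> j' = 1\<close> j by auto
    have "xi emin kA g i l r = ?n - 1 + (l - 2) * ?c + r" if "2 \<le> l" for l r
      using that by (simp add: xi_def)
    from this[OF j2(1), of q] this[OF j2(2), of q'] eq q
    have "(j - 2) * ?c + (q - 1) = (j' - 2) * ?c + (q' - 1)"
      by linarith
    then have "((j - 2) * ?c + (q - 1)) div ?c = ((j' - 2) * ?c + (q' - 1)) div ?c"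
      "((j - 2) * ?c + (q - 1)) mod ?c = ((j' - 2) * ?c + (q' - 1)) mod ?c"
      by simp_all
    moreover have "q - 1 < ?c" "q' - 1 < ?c" using q by auto
    ultimately have "j - 2 = j' - 2" "q - 1 = q' - 1" by simp_all
    then show ?thesis using j2 q by linarith
  qed
qed

text \<open>
  A vertex is selected only by the vertices with neighbouring labels in the next layer, which arrive
  within 2 time units of each other, and the POW duration is at least 2; hence it is still a tip for
  the last of them.  It is already visible because the layer width is at least
  \<open>h\<^sub>M + \<epsilon>\<^sub>m\<^sub>i\<^sub>n + 2\<close>.
\<close>

lemma allowed_parents_C:
  assumes st: "stage hM emin kA g i m" and i: "1 \<le> i"
    and m: "i + kappa_B emin kA \<le> m"
    and kA: "hM \<le> kA"
    and free: "3 * (hM + emin) < num_free_tips g (i + kA)"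
  shows "\<exists>v\<in>tips g (m - emin). \<exists>v'\<in>tips g (m - emin). allowed_parents hM emin kA g i m v v'"
proof -
  let ?n = "i + kappa_B emin kA" and ?c = "layer_width emin kA g i" and ?xi = "xi emin kA g i"
  have n: "1 \<le> ?n" using i by simp
  have n_eq: "?n = i + kA + (emin + 1)" by (simp add: kappa_B_def)
  \<comment> \<open>From \<open>i + kA\<close> to \<open>i + kappa_B\<close> the number of
    unreferenced vertices drops by at most \<open>emin + 1\<close>, so more than
    \<open>3 * (hM + emin)\<close> free tips leave at least \<open>3 * hM + 2 * emin\<close>
    vertices for the first layer.\<close>
  have c: "hM + emin + 2 \<le> ?c"
  proof -
    have "num_free_tips g (i + kA) \<le> card (unreferenced g (i + kA))"
      unfolding num_free_tips_def by (rule card_mono) (use i in \<open>auto simp: in_free_tips_iff\<close>)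
    also have "\<dots> \<le> card (unreferenced g ?n) + (emin + 1)"
      using card_unreferenced_add[of "i + kA" "emin + 1"] i unfolding n_eq by simp
    also have "unreferenced g ?n = first_layer emin kA g i"
      using unreferenced_eq[OF n] by (simp add: first_layer_def)
    finally show ?thesis using free hM_ge_2 by (simp add: layer_width_def)
  qed
  \<comment> \<open>This inverts the labelling: arrivals from \<open>i + kappa_B\<close> on start in
    layer 2, and positions count from 1.\<close>
  define j where "j = (m - ?n) div ?c + 2"
  define k where "k = (m - ?n) mod ?c + 1"
  have j: "2 \<le> j" and k: "1 \<le> k" "k \<le> ?c"
    using c by (auto simp: j_def k_def Suc_le_eq)
  have "(m - ?n) div ?c * ?c + (m - ?n) mod ?c = m - ?n" by simp
  then have m_eq: "m = ?n + (j - 2) * ?c + (k - 1)"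
    using m by (simp add: j_def k_def)
  have xi_later: "?xi l q = ?n - 1 + (l - 2) * ?c + q" if "2 \<le> l" for l q
    using that by (simp add: xi_def)
  have m_xi: "m = ?xi j k"
    unfolding xi_later[OF j] using m_eq k n by linarith
  have tip: "?xi (j - 1) q \<in> tips g (m - emin)"
    if q: "1 \<le> q" "q \<le> ?c" "q \<le> k + 1" "k \<le> q + 1" for q
  proof -
    let ?x = "?xi (j - 1) q"
    have "j - 1 - 1 = j - 2" by simp
    then have "?x + ?c < ?n + (j - 2) * ?c + q"
      using xi_layer_less[OF i _ q(1,2), of "j - 1"] j by simp
    \<comment> \<open>The two spare units in the lower bound on the width absorb
      \<open>q \<le> k + 1\<close> and the offset \<open>k - 1\<close> in
      \<open>m_eq\<close>.\<close>
    then have "?x + hM + emin < m"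
      using c m_eq q k by linarith
    then have x_less: "?x + hM < m - emin" by linarith
    have Vs: "m - emin \<le> m" "i + hM \<le> m - emin" using m kA by (auto simp: kappa_B_def)
    have V: "?x \<in> vertices g (m - emin)"
      using x_less vertices_stage[OF st i Vs(2,1)] by simp
    moreover have "?x \<noteq> parent1 g w \<and> ?x \<noteq> parent2 g w"
      if w: "1 \<le> w" "w + pow_time g w < m - emin" for w
    proof (cases "w < ?n")
      \<comment> \<open>An arrival before the layered phase cannot have chosen \<open>?x\<close>: in
        the first layer \<open>?x\<close> is unreferenced at time \<open>?n\<close>, and in a later
        layer it has not yet arrived.\<close>
      case True
      show ?thesis
      proof (cases "j = 2")
        case True
        then have "?x \<in> unreferenced g ?n" using xi_first_layer[OF i q(1,2)] by simp
        then show ?thesis using w \<open>w < ?n\<close> by (auto simp: unreferenced_def)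
      next
        case False
        then have "2 \<le> j - 1" using j by simp
        then have "?n \<le> ?x" using xi_later[of "j - 1" q] q n by linarith
        then show ?thesis using parents_less[OF w(1)] True by auto
      qed
    next
      case False
      have "w < m" using w by simp
      then have "pow_time g w = hM" "allowed_parents hM emin kA g i w (parent1 g w) (parent2 g w)"
        using st False by (auto simp: stage_def)
      then obtain j' k' where w': "2 \<le> j'" "1 \<le> k'" "k' \<le> ?c" "w = ?xi j' k'"
        "parent1 g w = ?xi (j' - 1) (max 1 (k' - 1))" "parent2 g w = ?xi (j' - 1) (min (k' + 1) ?c)"
        using False unfolding allowed_parents_def by (auto simp: kappa_B_def)
      have no: "?x \<noteq> ?xi (j' - 1) r" if r: "1 \<le> r" "r \<le> ?c" "r \<le> k' + 1" "k' \<le> r + 1" for r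
      proof
        assume "?x = ?xi (j' - 1) r"
        from xi_inj[OF i this] have "j - 1 = j' - 1" "q = r"
          using j w'(1) q r by auto
        then have "j = j'" using j w'(1) by simp
        then have "w = ?n + (j - 2) * ?c + (k' - 1)" using xi_later[OF j] w'(2,4) n by simp
        \<comment> \<open>Both \<open>k\<close> and \<open>k'\<close> differ from the common
          position \<open>q\<close> by at most one, so two children of \<open>?x\<close> are at most
          2 apart, whereas a finished \<open>w\<close> would satisfy
          \<open>w + hM < m - emin\<close>.\<close>
        then have "m \<le> w + 2" using m_eq \<open>q = r\<close> q r w'(2) k by linarith
        then show False using w(2) \<open>pow_time g w = hM\<close> hM_ge_2 emin_pos by linarith
      qed
      have "?x \<noteq> ?xi (j' - 1) (max 1 (k' - 1))" by (rule no) (use w'(2,3) in auto)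
      moreover have "?x \<noteq> ?xi (j' - 1) (min (k' + 1) ?c)" by (rule no) (use w'(2,3) in auto)
      ultimately show ?thesis using w'(5,6) by metis
    qed
    ultimately show ?thesis by (simp add: in_tips_iff)
  qed
  let ?v = "?xi (j - 1) (max 1 (k - 1))" and ?v' = "?xi (j - 1) (min (k + 1) ?c)"
  have "?v \<in> tips g (m - emin)" by (rule tip) (use k c in auto)
  moreover have "?v' \<in> tips g (m - emin)" by (rule tip) (use k c in auto)
  moreover have "allowed_parents hM emin kA g i m ?v ?v'"
    using m j k m_xi unfolding allowed_parents_def by (auto simp: kappa_B_def)
  ultimately show ?thesis by blast
qed

text \<open>The lower bound on free tips is available only on event \<open>A\<close>; by the time it
  is needed, at \<open>i + kA\<close>, the stage condition has already established that
  event.\<close>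

lemma allowed_parents_exist:
  assumes st: "stage hM emin kA g i m" and i: "1 \<le> i" "i \<le> m"
    and kA: "hM + emin \<le> kA"
    and free: "event_A hM emin kA g i \<Longrightarrow> 3 * (hM + emin) < num_free_tips g (i + kA)"
  shows "\<exists>v\<in>tips g (m - emin). \<exists>v'\<in>tips g (m - emin). allowed_parents hM emin kA g i m v v'"
proof (cases "m < i + kA")
  case True
  then show ?thesis by (rule allowed_parents_A)
next
  case False
  then have "event_A hM emin kA g i" using stage_event_A[OF st] by simp
  note f = free[OF this]
  show ?thesis
  proof (cases "m < i + kappa_B emin kA")
    case True
    then show ?thesis using False f kA st i by (intro allowed_parents_B) auto
  next
    case F: False
    then show ?thesis using f kA st i by (intro allowed_parents_C) auto
  qed
qed

end

section \<open>The law of an arrival given the past\<close>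

lemma agree_allowed_parents:
  assumes "agree n g g'" "m \<le> Suc n"
  shows "allowed_parents hM emin kA g i m v v' \<longleftrightarrow> allowed_parents hM emin kA g' i m v v'"
proof -
  have tips: "tips g (m - emin) = tips g' (m - emin)" "free_tips g m = free_tips g' m"
    using assms by (auto intro!: agree_tips agree_free_tips)
  \<comment> \<open>Reserved tips and layers are consulted only once \<open>m\<close> has reached
    the time at which they are read off; hence the guards here and below.\<close>
  have reserved: "reserved_tips hM emin kA g i = reserved_tips hM emin kA g' i" if "i + kA \<le> m"
    using that assms agree_free_tips[OF assms(1), of "i + kA"] by (simp add: reserved_tips_def)
  have "first_layer emin kA g i = first_layer emin kA g' i" if "i + kappa_B emin kA \<le> m"
    using that assms agree_free_tips[OF assms(1), of "i + kappa_B emin kA"]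
      agree_unfinished[OF assms(1), of "i + kappa_B emin kA"] by (simp add: first_layer_def)
  then have xi: "xi emin kA g i = xi emin kA g' i" "layer_width emin kA g i = layer_width emin kA g' i"
    if "i + kappa_B emin kA \<le> m"
    using that by (auto simp: xi_def layer_width_def fun_eq_iff)
  show ?thesis
    unfolding allowed_parents_def using tips reserved xi by (simp add: not_less)
qed

lemma agree_stage:
  assumes "agree n g g'" "1 \<le> i" "m \<le> Suc n"
  shows "stage hM emin kA g i m \<longleftrightarrow> stage hM emin kA g' i m"
proof -
  have "pow_time g k = hM \<and> lag g k = emin \<and> allowed_parents hM emin kA g i k (parent1 g k) (parent2 g k) \<longleftrightarrow>
    pow_time g' k = hM \<and> lag g' k = emin \<and> allowed_parents hM emin kA g' i k (parent1 g' k) (parent2 g' k)"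
    if "i \<le> k \<and> k < m" for k
  proof -
    have k: "1 \<le> k" "k \<le> n" using that assms by auto
    show ?thesis
      unfolding agree_at[OF assms(1) k] using agree_allowed_parents[OF assms(1), of k] k by simp
  qed
  then show ?thesis unfolding stage_def by blast
qed

text \<open>The first two hypotheses make \<open>K\<close> the integer part of
  \<open>kappa_C\<close>. The window being closed, the last prescribed arrival is
  \<open>i + K\<close>, and the excluded end point is \<open>Suc (i + K)\<close>.\<close>

lemma bottleneck_iff_stage:
  assumes "kappa_C M hM emin emax b kA < real K + 1" "real K \<le> kappa_C M hM emin emax b kA"
    "kappa_B emin kA \<le> K"
  shows "bottleneck M hM emin emax b kA g i \<longleftrightarrow>
    real (num_tips g i) \<le> b \<and> stage hM emin kA g i (Suc (i + K))"
proof
  assume *: "real (num_tips g i) \<le> b \<and> stage hM emin kA g i (Suc (i + K))"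
  then have st: "stage hM emin kA g i (Suc (i + K))" by blast
  have "i + kA \<le> Suc (i + K)" "i + kappa_B emin kA \<le> Suc (i + K)"
    using assms(3) by (auto simp: kappa_B_def)
  then show "bottleneck M hM emin emax b kA g i"
    unfolding bottleneck_def
    using * stage_event_A[OF st] stage_event_B[OF st] stage_event_C[OF st assms(1)] by blast
next
  assume *: "bottleneck M hM emin emax b kA g i"
  then have A: "event_A hM emin kA g i" and B: "event_B hM emin kA g i"
    and C: "event_C M hM emin emax b kA g i" by (auto simp: bottleneck_def)
  have "pow_time g m = hM \<and> lag g m = emin \<and>
       allowed_parents hM emin kA g i m (parent1 g m) (parent2 g m)" if m: "i \<le> m" "m < Suc (i + K)" for m
  proof -
    consider "m < i + kA" | "\<not> m < i + kA" "m < i + kappa_B emin kA" | "i + kappa_B emin kA \<le> m"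
      by linarith
    then show ?thesis
    proof cases
      case 1
      then show ?thesis
        using A[unfolded event_A_def, rule_format, of m] m unfolding allowed_parents_def
        by (auto split: if_splits)
    next
      case 2
      then show ?thesis
        using B[unfolded event_B_def, rule_format, of m] m unfolding allowed_parents_def by auto
    next
      case 3
      moreover have "real m \<le> real i + kappa_C M hM emin emax b kA" using m assms(2) by linarith
      ultimately show ?thesis
        using C[unfolded event_C_def, rule_format, of m] unfolding allowed_parents_def
        by (auto simp: kappa_B_def)
    qed
  qed
  then have "stage hM emin kA g i (Suc (i + K))" by (auto simp: stage_def)
  then show "real (num_tips g i) \<le> b \<and> stage hM emin kA g i (Suc (i + K))"
    using * by (simp add: bottleneck_def)
qed

section \<open>Coding the past in a countable type\<close>

definition history_code :: "nat \<Rightarrow> realisation \<Rightarrow> (nat \<times> nat \<times> nat \<times> nat) list" where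
  "history_code n g = map (\<lambda>m. (pow_time g (Suc m), lag g (Suc m), parent1 g (Suc m), parent2 g (Suc m))) [0..<n]"

text \<open>Coordinate \<open>m\<close> sits at list position \<open>m - 1\<close>. Positions past
  the end of the list give unspecified values, which is harmless because only coordinates from 1 to
  \<open>n\<close> are compared.\<close>

definition history_decode :: "(nat \<times> nat \<times> nat \<times> nat) list \<Rightarrow> realisation" where
  "history_decode l = \<lparr>pow_time = (\<lambda>m. fst (l ! (m - 1))), lag = (\<lambda>m. fst (snd (l ! (m - 1)))),
     parent1 = (\<lambda>m. fst (snd (snd (l ! (m - 1))))), parent2 = (\<lambda>m. snd (snd (snd (l ! (m - 1)))))\<rparr>"

lemma agree_history_decode: "agree n g (history_decode (history_code n g))"
  by (auto simp: agree_def history_code_def history_decode_def)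

text \<open>The right-hand side is the mean number of distinct elements of \<open>F\<close> among
  two independent uniform picks from \<open>T\<close>. With \<open>L = card T\<close> and
  \<open>f = card (T \<inter> F)\<close> it equals \<open>(2 * L - 1) * f / L^2\<close>, and
  \<open>f\<close> is at least \<open>L - d\<close>.\<close>

lemma sum_card_pair_Int_ge:
  fixes T F :: "'a set"
  assumes T: "finite T" "T \<noteq> {}" and d: "card (T - F) \<le> d"
  shows "2 - (2 * real d + 1) / real (card T)
    \<le> (\<Sum>v\<in>T. \<Sum>v'\<in>T. real (card ({v, v'} \<inter> F))) / (real (card T))\<^sup>2"
proof -
  let ?L = "real (card T)" and ?f = "real (card (T \<inter> F))"
  have L: "1 \<le> ?L" using T by (simp add: Suc_le_eq card_gt_0_iff)
  \<comment> \<open>Inclusion-exclusion: the last term corrects for a coinciding pair.\<close>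
  have pair: "real (card ({v, v'} \<inter> F)) = of_bool (v \<in> F) + of_bool (v' \<in> F) - of_bool (v = v' \<and> v \<in> F)"
    for v v' :: 'a
    by (cases "v \<in> F"; cases "v' \<in> F") (auto simp: Int_insert_left card_insert_if)
  have 1: "(\<Sum>v\<in>T. of_bool (v \<in> F)) = ?f"
    using T by (simp add: sum.If_cases of_bool_def Int_def)
  have "(\<Sum>v'\<in>T. of_bool (v = v' \<and> v \<in> F)) = (of_bool (v \<in> F) :: real)" if "v \<in> T" for v
  proof -
    have "(\<Sum>v'\<in>T. of_bool (v = v' \<and> v \<in> F)) = (\<Sum>v'\<in>T. if v' = v then of_bool (v \<in> F) else (0::real))"
      by (intro sum.cong) auto
    then show ?thesis using that T by simp
  qed
  then have "(\<Sum>v\<in>T. \<Sum>v'\<in>T. real (card ({v, v'} \<inter> F))) = ?L * ?f + ?L * ?f - ?f"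
    using 1 unfolding pair sum.distrib sum_subtractf by (simp add: sum_distrib_left[symmetric])
  also have "\<dots> = (2 * ?L - 1) * ?f" by (simp add: algebra_simps)
  finally have sum: "(\<Sum>v\<in>T. \<Sum>v'\<in>T. real (card ({v, v'} \<inter> F))) = (2 * ?L - 1) * ?f" .
  have "card T = card (T \<inter> F) + card (T - F)"
    using T by (metis Int_Diff_Un Int_Diff_disjoint card_Un_disjoint finite_Diff finite_Int)
  then have "?L - real d \<le> ?f" using d by linarith
  then have "(2 * ?L - 1) * (?L - real d) \<le> (2 * ?L - 1) * ?f" using L by (intro mult_left_mono) auto
  moreover have "(2 - (2 * real d + 1) / ?L) * ?L\<^sup>2 = 2 * ?L\<^sup>2 - (2 * real d + 1) * ?L"
    using L by (simp add: field_simps power2_eq_square)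
  moreover have "(2 * ?L - 1) * (?L - real d) = 2 * ?L\<^sup>2 - (2 * real d + 1) * ?L + real d"
    by (simp add: algebra_simps power2_eq_square)
  ultimately have "(2 - (2 * real d + 1) / ?L) * ?L\<^sup>2 \<le> (2 * ?L - 1) * ?f" by linarith
  then show ?thesis unfolding sum using L by (simp add: pos_le_divide_eq)
qed

context tangle_model
begin

abbreviation hM :: nat where "hM \<equiv> h M"
abbreviation emin :: nat where "emin \<equiv> Min I"
abbreviation emax :: nat where "emax \<equiv> Max I"

lemma h_bounds:
  assumes "k \<in> {1..M}"
  shows "h 1 \<le> h k" "h k \<le> hM"
  using assms M_ge_2 strict_mono_on_leD[OF h_increasing, of 1 k]
    strict_mono_on_leD[OF h_increasing, of k M] by auto

lemma hM_ge_2: "2 \<le> hM"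
  using strict_mono_onD[OF h_increasing, of 1 M] M_ge_2 h_pos by auto

lemma lag_bounds: "j \<in> I \<Longrightarrow> emin \<le> j" "j \<in> I \<Longrightarrow> j \<le> emax" "emin \<in> I" "1 \<le> emin"
  using I_finite I_nonempty I_pos[of emin] by (auto simp: Suc_le_eq)

lemma space_history [simp]: "space (history P W n) = space P"
  unfolding history_def by (rule space_measure_of) auto

lemma sets_history:
  "sets (history P W n) = sigma_sets (space P) {(\<lambda>\<omega>. f (W \<omega>) m) -` A \<inter> space P | f m A.
        f \<in> {pow_time, lag, parent1, parent2} \<and> 1 \<le> m \<and> m \<le> n}"
  unfolding history_def by (rule sets_measure_of) auto

lemma subalgebra_history: "subalgebra P (history P W n)"
proof -
  have "sigma_sets (space P) {(\<lambda>\<omega>. f (W \<omega>) m) -` A \<inter> space P | f m A.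
        f \<in> {pow_time, lag, parent1, parent2} \<and> 1 \<le> m \<and> m \<le> n} \<subseteq> sets P"
  proof (intro sets.sigma_sets_subset subsetI)
    fix X assume "X \<in> {(\<lambda>\<omega>. f (W \<omega>) m) -` A \<inter> space P | f m A.
        f \<in> {pow_time, lag, parent1, parent2} \<and> 1 \<le> m \<and> m \<le> n}"
    then obtain f m A where X: "X = (\<lambda>\<omega>. f (W \<omega>) m) -` A \<inter> space P"
      and f: "f \<in> {pow_time, lag, parent1, parent2}" "1 \<le> m" by blast
    show "X \<in> sets P"
      unfolding X by (rule measurable_sets[OF random_variables[OF f]]) simp
  qed
  then show ?thesis by (simp add: subalgebra_def sets_history)
qed

sublocale past: finite_measure_subalgebra P "history P W n" for n
  by unfold_locales (rule subalgebra_history)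

lemma measurable_coordinate:
  assumes "f \<in> {pow_time, lag, parent1, parent2}" "1 \<le> m" "m \<le> n"
  shows "(\<lambda>\<omega>. f (W \<omega>) m) \<in> measurable (history P W n) (count_space UNIV)"
proof (rule measurableI)
  fix A :: "nat set"
  show "(\<lambda>\<omega>. f (W \<omega>) m) -` A \<inter> space (history P W n) \<in> sets (history P W n)"
    unfolding sets_history space_history by (rule sigma_sets.Basic) (use assms in blast)
qed simp

lemma measurable_history_code:
  "(\<lambda>\<omega>. history_code n (W \<omega>)) \<in> measurable (history P W n) (count_space UNIV)"
proof -
  have "(\<lambda>\<omega>. history_code n (W \<omega>)) -` {l} \<inter> space (history P W n) \<in> sets (history P W n)" for l
  proof (cases "length l = n")
    case True
    have eq: "(\<lambda>\<omega>. history_code n (W \<omega>)) -` {l} \<inter> space (history P W n) =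
      {\<omega> \<in> space (history P W n). \<forall>m\<in>{..<n}. pow_time (W \<omega>) (Suc m) = fst (l ! m) \<and>
        lag (W \<omega>) (Suc m) = fst (snd (l ! m)) \<and> parent1 (W \<omega>) (Suc m) = fst (snd (snd (l ! m))) \<and>
        parent2 (W \<omega>) (Suc m) = snd (snd (snd (l ! m)))}"
    proof -
      have "history_code n g = l \<longleftrightarrow> (\<forall>m\<in>{..<n}. pow_time g (Suc m) = fst (l ! m) \<and>
        lag g (Suc m) = fst (snd (l ! m)) \<and> parent1 g (Suc m) = fst (snd (snd (l ! m))) \<and>
        parent2 g (Suc m) = snd (snd (snd (l ! m))))" for g
      proof -
        have "history_code n g = l \<longleftrightarrow> (\<forall>m<n. history_code n g ! m = l ! m)"
          using True by (simp add: list_eq_iff_nth_eq history_code_def)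
        also have "\<dots> \<longleftrightarrow> (\<forall>m<n. (pow_time g (Suc m), lag g (Suc m), parent1 g (Suc m), parent2 g (Suc m)) = l ! m)"
          by (simp add: history_code_def)
        finally show ?thesis by (simp only: prod_eq_iff fst_conv snd_conv Ball_def lessThan_iff)
      qed
      then show ?thesis by blast
    qed
    have "{\<omega> \<in> space (history P W n). f (W \<omega>) (Suc m) = a} \<in> sets (history P W n)"
      if "f \<in> {pow_time, lag, parent1, parent2}" "m < n" for f m a
    proof -
      have "{\<omega> \<in> space (history P W n). f (W \<omega>) (Suc m) = a}
          = (\<lambda>\<omega>. f (W \<omega>) (Suc m)) -` {a} \<inter> space (history P W n)" by auto
      also have "\<dots> \<in> sets (history P W n)"
        by (rule measurable_sets[OF measurable_coordinate]) (use that in auto)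
      finally show ?thesis .
    qed
    then show ?thesis
      unfolding eq by (intro sets.sets_Collect_finite_All sets.sets_Collect_conj) auto
  next
    case False
    then have "(\<lambda>\<omega>. history_code n (W \<omega>)) -` {l} \<inter> space (history P W n) = {}"
      by (auto simp: history_code_def)
    then show ?thesis by simp
  qed
  then show ?thesis by (simp add: measurable_count_space_eq2_countable)
qed

text \<open>The function factors through the list code of the past, and every function on a
  countable discrete space is measurable.\<close>

lemma measurable_history_determined:
  fixes f :: "realisation \<Rightarrow> 'b"
  assumes "determined n f" "range f \<subseteq> space N"
  shows "(\<lambda>\<omega>. f (W \<omega>)) \<in> measurable (history P W n) N"
proof -
  have eq: "f (W \<omega>) = f (history_decode (history_code n (W \<omega>)))" for \<omega>
    by (rule determinedD[OF assms(1) agree_history_decode])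
  have "(\<lambda>l. f (history_decode l)) \<in> measurable (count_space UNIV) N"
    using assms(2) by (simp add: Pi_iff image_subset_iff)
  from measurable_compose[OF measurable_history_code[of n] this] show ?thesis
    unfolding eq[symmetric] .
qed

lemma borel_measurable_determined:
  fixes f :: "realisation \<Rightarrow> real"
  assumes "determined n f"
  shows "(\<lambda>\<omega>. f (W \<omega>)) \<in> borel_measurable (history P W n)" "(\<lambda>\<omega>. f (W \<omega>)) \<in> borel_measurable P"
proof -
  show "(\<lambda>\<omega>. f (W \<omega>)) \<in> borel_measurable (history P W n)"
    by (rule measurable_history_determined[OF assms]) simp
  then show "(\<lambda>\<omega>. f (W \<omega>)) \<in> borel_measurable P"
    by (rule measurable_from_subalg[OF subalgebra_history])
qed

lemma sets_determined:
  assumes "determined n f"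
  shows "{\<omega> \<in> space P. f (W \<omega>)} \<in> sets P"
proof -
  have "(\<lambda>\<omega>. f (W \<omega>)) \<in> measurable (history P W n) (count_space UNIV)"
    by (rule measurable_history_determined[OF assms]) simp
  then have "(\<lambda>\<omega>. f (W \<omega>)) \<in> measurable P (count_space UNIV)"
    by (rule measurable_from_subalg[OF subalgebra_history])
  then show ?thesis by simp
qed

lemma integrable_determined:
  fixes f :: "realisation \<Rightarrow> real"
  assumes "determined n f" "\<And>g. \<bar>f g\<bar> \<le> B"
  shows "integrable P (\<lambda>\<omega>. f (W \<omega>))"
  by (rule integrable_const_bound[where B = B])
    (use assms borel_measurable_determined in auto)

lemma prob_determined:
  assumes "determined n f"
  shows "(\<integral>\<omega>. of_bool (f (W \<omega>)) \<partial>P) = prob {\<omega> \<in> space P. f (W \<omega>)}"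
proof -
  have "(\<integral>\<omega>. of_bool (f (W \<omega>)) \<partial>P) = (\<integral>\<omega>. indicator {\<omega> \<in> space P. f (W \<omega>)} \<omega> \<partial>P)"
    by (intro Bochner_Integration.integral_cong) (auto simp: indicator_def)
  also have "\<dots> = prob {\<omega> \<in> space P. f (W \<omega>)}"
    using sets_determined[OF assms] by (simp add: Int_absorb1 subset_iff)
  finally show ?thesis .
qed

section \<open>Integrating over the outcome of one arrival\<close>

definition arrival :: "nat \<Rightarrow> nat \<Rightarrow> nat \<Rightarrow> nat \<Rightarrow> nat \<Rightarrow> 'a set" where
  "arrival n a j v v' = {\<omega> \<in> space P. pow_time (W \<omega>) n = a \<and> lag (W \<omega>) n = j
     \<and> parent1 (W \<omega>) n = v \<and> parent2 (W \<omega>) n = v'}"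

lemma sets_arrival: "1 \<le> n \<Longrightarrow> arrival n a j v v' \<in> sets P"
  unfolding arrival_def
  by (rule sets_determined[of n "\<lambda>g. pow_time g n = a \<and> lag g n = j \<and> parent1 g n = v \<and> parent2 g n = v'"])
    (auto simp: determined_def agree_def)

lemma integrable_arrival:
  assumes n: "1 \<le> n" and det: "determined (n - 1) \<phi>" and bound: "\<And>g. \<bar>\<phi> g\<bar> \<le> (B :: real)"
  shows "integrable P (\<lambda>\<omega>. \<phi> (W \<omega>) * indicator (arrival n a j v v') \<omega>)"
  by (intro integrable_real_mult_indicator sets_arrival n integrable_determined[OF det bound])

text \<open>The conditional law in integrated form: tested against a function of the past, the
  indicator of an outcome may be replaced by its conditional probability.\<close>

lemma integral_arrival:
  assumes n: "1 \<le> n" and k: "k \<in> {1..M}" and j: "j \<in> I"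
    and det: "determined (n - 1) \<phi>" and bound: "\<And>g. \<bar>\<phi> g\<bar> \<le> (B :: real)"
  shows "(\<integral>\<omega>. \<phi> (W \<omega>) * indicator (arrival n (h k) j v v') \<omega> \<partial>P) =
    (\<integral>\<omega>. \<phi> (W \<omega>) * (p_pow k * p_lag j / (real (num_tips (W \<omega>) (n - j)))\<^sup>2
             * of_bool (v \<in> tips (W \<omega>) (n - j) \<and> v' \<in> tips (W \<omega>) (n - j))) \<partial>P)"
proof -
  let ?E = "arrival n (h k) j v v'"
  have [measurable]: "?E \<in> sets P" by (rule sets_arrival[OF n])
  have "(\<integral>\<omega>. \<phi> (W \<omega>) * indicator ?E \<omega> \<partial>P)
      = (\<integral>\<omega>. \<phi> (W \<omega>) * real_cond_exp P (history P W (n - 1)) (indicator ?E) \<omega> \<partial>P)"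
    by (rule past.real_cond_exp_intg(2)[symmetric])
      (use integrable_arrival[OF n det bound] borel_measurable_determined(1)[OF det] in auto)
  also have "\<dots> = (\<integral>\<omega>. \<phi> (W \<omega>) * (p_pow k * p_lag j / (real (num_tips (W \<omega>) (n - j)))\<^sup>2
             * of_bool (v \<in> tips (W \<omega>) (n - j) \<and> v' \<in> tips (W \<omega>) (n - j))) \<partial>P)"
  proof (rule integral_cong_AE)
    have 1: "(\<lambda>\<omega>. \<phi> (W \<omega>)) \<in> borel_measurable P" by (rule borel_measurable_determined(2)[OF det])
    have "determined (n - 1) (\<lambda>g. p_pow k * p_lag j / (real (num_tips g (n - j)))\<^sup>2
             * of_bool (v \<in> tips g (n - j) \<and> v' \<in> tips g (n - j)))"
      using agree_tips[of "n - 1" _ _ "n - j"] n unfolding determined_def num_tips_def by simp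
    from borel_measurable_determined(2)[OF this]
    show "(\<lambda>\<omega>. \<phi> (W \<omega>) * (p_pow k * p_lag j / (real (num_tips (W \<omega>) (n - j)))\<^sup>2
             * of_bool (v \<in> tips (W \<omega>) (n - j) \<and> v' \<in> tips (W \<omega>) (n - j)))) \<in> borel_measurable P"
      by (rule borel_measurable_times[OF 1])
    show "(\<lambda>\<omega>. \<phi> (W \<omega>) * real_cond_exp P (history P W (n - 1)) (indicator ?E) \<omega>) \<in> borel_measurable P"
      by (rule borel_measurable_times[OF 1]) simp
    show "AE \<omega> in P. \<phi> (W \<omega>) * real_cond_exp P (history P W (n - 1)) (indicator ?E) \<omega> =
      \<phi> (W \<omega>) * (p_pow k * p_lag j / (real (num_tips (W \<omega>) (n - j)))\<^sup>2
             * of_bool (v \<in> tips (W \<omega>) (n - j) \<and> v' \<in> tips (W \<omega>) (n - j)))"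
      using law[OF n k j, of v v'] unfolding arrival_def by eventually_elim simp
  qed
  finally show ?thesis .
qed

text \<open>Testing the law against the indicator that \<open>v\<close>, \<open>v'\<close> are not
  both tips gives integral 0, so each such outcome is null; there are only countably many outcomes
  and times.\<close>

lemma AE_parents_tips:
  "AE \<omega> in P. \<forall>n\<ge>1. parent1 (W \<omega>) n \<in> tips (W \<omega>) (n - lag (W \<omega>) n) \<and>
     parent2 (W \<omega>) n \<in> tips (W \<omega>) (n - lag (W \<omega>) n)"
proof -
  have "AE \<omega> in P. \<forall>k\<in>{1..M}. \<forall>j\<in>I. \<forall>v v'. \<omega> \<in> arrival n (h k) j v v' \<longrightarrow>
      v \<in> tips (W \<omega>) (n - j) \<and> v' \<in> tips (W \<omega>) (n - j)" if n: "1 \<le> n" for n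
  proof -
    have "AE \<omega> in P. \<omega> \<in> arrival n (h k) j v v' \<longrightarrow>
      v \<in> tips (W \<omega>) (n - j) \<and> v' \<in> tips (W \<omega>) (n - j)" if k: "k \<in> {1..M}" and j: "j \<in> I" for k j v v'
    proof -
      define \<phi> :: "realisation \<Rightarrow> real" where
        "\<phi> g = of_bool (\<not> (v \<in> tips g (n - j) \<and> v' \<in> tips g (n - j)))" for g
      have det: "determined (n - 1) \<phi>"
        using agree_tips[of "n - 1" _ _ "n - j"] n unfolding determined_def \<phi>_def by simp
      have bound: "\<bar>\<phi> g\<bar> \<le> 1" for g by (simp add: \<phi>_def)
      have "(\<integral>\<omega>. \<phi> (W \<omega>) * indicator (arrival n (h k) j v v') \<omega> \<partial>P) = 0"
      proof -
        have zero: "\<phi> g * (c * of_bool (v \<in> tips g (n - j) \<and> v' \<in> tips g (n - j))) = 0" for g c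
          by (auto simp: \<phi>_def)
        show ?thesis unfolding integral_arrival[OF n k j det bound] zero by simp
      qed
      moreover have "AE \<omega> in P. 0 \<le> \<phi> (W \<omega>) * indicator (arrival n (h k) j v v') \<omega>"
        by (auto simp: \<phi>_def)
      ultimately have "AE \<omega> in P. \<phi> (W \<omega>) * indicator (arrival n (h k) j v v') \<omega> = 0"
        using integral_nonneg_eq_0_iff_AE[OF integrable_arrival[OF n det bound]] by blast
      then show ?thesis by eventually_elim (auto simp: \<phi>_def indicator_def split: if_splits)
    qed
    then show ?thesis using I_finite by (simp add: AE_ball_countable AE_all_countable countable_finite)
  qed
  then have "AE \<omega> in P. \<forall>n. 1 \<le> n \<longrightarrow> (\<forall>k\<in>{1..M}. \<forall>j\<in>I. \<forall>v v'. \<omega> \<in> arrival n (h k) j v v' \<longrightarrow>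
      v \<in> tips (W \<omega>) (n - j) \<and> v' \<in> tips (W \<omega>) (n - j))"
    unfolding AE_all_countable using AE_impI by auto
  then show ?thesis
  proof (rule AE_mp, intro AE_I2 impI allI)
    fix \<omega> and n :: nat assume \<omega>: "\<omega> \<in> space P" and n: "1 \<le> n"
      and *: "\<forall>n. 1 \<le> n \<longrightarrow> (\<forall>k\<in>{1..M}. \<forall>j\<in>I. \<forall>v v'. \<omega> \<in> arrival n (h k) j v v' \<longrightarrow>
      v \<in> tips (W \<omega>) (n - j) \<and> v' \<in> tips (W \<omega>) (n - j))"
    obtain k where "k \<in> {1..M}" "pow_time (W \<omega>) n = h k" using pow_time_range[OF n \<omega>] by auto
    moreover have "lag (W \<omega>) n \<in> I" by (rule lag_range[OF n \<omega>])
    moreover have "\<omega> \<in> arrival n (pow_time (W \<omega>) n) (lag (W \<omega>) n) (parent1 (W \<omega>) n) (parent2 (W \<omega>) n)"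
      using \<omega> by (simp add: arrival_def)
    ultimately show "parent1 (W \<omega>) n \<in> tips (W \<omega>) (n - lag (W \<omega>) n) \<and>
     parent2 (W \<omega>) n \<in> tips (W \<omega>) (n - lag (W \<omega>) n)" using * n by metis
  qed
qed

lemma AE_tangle_run: "AE \<omega> in P. tangle_run (W \<omega>) (h 1) hM emin"
  using AE_parents_tips
proof (rule AE_mp, intro AE_I2 impI)
  fix \<omega> assume \<omega>: "\<omega> \<in> space P"
    and par: "\<forall>n\<ge>1. parent1 (W \<omega>) n \<in> tips (W \<omega>) (n - lag (W \<omega>) n) \<and>
     parent2 (W \<omega>) n \<in> tips (W \<omega>) (n - lag (W \<omega>) n)"
  show "tangle_run (W \<omega>) (h 1) hM emin"
  proof
    fix n :: nat assume n: "1 \<le> n"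
    obtain k where k: "k \<in> {1..M}" "pow_time (W \<omega>) n = h k" using pow_time_range[OF n \<omega>] by auto
    show "h 1 \<le> pow_time (W \<omega>) n" "pow_time (W \<omega>) n \<le> hM" using h_bounds[OF k(1)] k(2) by auto
  qed (use par h_pos hM_ge_2 lag_bounds in auto)
qed

text \<open>The integrand is split over the possible outcomes of arrival \<open>n\<close>. Parents
  are almost surely below \<open>n\<close>, so finitely many outcomes suffice, and the integrated
  law applies to each. What remains is the average over duration, lag and a uniform pair of
  tips.\<close>

lemma expectation_arrival:
  fixes \<psi> :: "realisation \<Rightarrow> nat \<Rightarrow> nat \<Rightarrow> nat \<Rightarrow> nat \<Rightarrow> real"
  assumes n: "1 \<le> n" and det: "\<And>a j v v'. determined (n - 1) (\<lambda>g. \<psi> g a j v v')"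
    and bound: "\<And>g a j v v'. \<bar>\<psi> g a j v v'\<bar> \<le> B"
  shows "(\<integral>\<omega>. \<psi> (W \<omega>) (pow_time (W \<omega>) n) (lag (W \<omega>) n) (parent1 (W \<omega>) n) (parent2 (W \<omega>) n) \<partial>P) =
    (\<integral>\<omega>. (\<Sum>k\<in>{1..M}. \<Sum>j\<in>I. p_pow k * p_lag j *
       ((\<Sum>v\<in>tips (W \<omega>) (n - j). \<Sum>v'\<in>tips (W \<omega>) (n - j). \<psi> (W \<omega>) (h k) j v v') /
         (real (card (tips (W \<omega>) (n - j))))\<^sup>2)) \<partial>P)"
    (is "?lhs = (\<integral>\<omega>. ?rhs \<omega> \<partial>P)")
    and "integrable P (\<lambda>\<omega>. \<Sum>k\<in>{1..M}. \<Sum>j\<in>I. p_pow k * p_lag j *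
       ((\<Sum>v\<in>tips (W \<omega>) (n - j). \<Sum>v'\<in>tips (W \<omega>) (n - j). \<psi> (W \<omega>) (h k) j v v') /
         (real (card (tips (W \<omega>) (n - j))))\<^sup>2))"
proof -
  let ?q = "\<lambda>\<omega> k j v v'. p_pow k * p_lag j / (real (num_tips (W \<omega>) (n - j)))\<^sup>2
             * of_bool (v \<in> tips (W \<omega>) (n - j) \<and> v' \<in> tips (W \<omega>) (n - j))"
  have det_q: "determined (n - 1) (\<lambda>g. p_pow k * p_lag j / (real (num_tips g (n - j)))\<^sup>2
             * of_bool (v \<in> tips g (n - j) \<and> v' \<in> tips g (n - j)))" for k j v v'
    using agree_tips[of "n - 1" _ _ "n - j"] n unfolding determined_def num_tips_def by simp
  have det_\<psi>q: "determined (n - 1) (\<lambda>g. \<psi> g a j v v' * (p_pow k * p_lag j / (real (num_tips g (n - j)))\<^sup>2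
             * of_bool (v \<in> tips g (n - j) \<and> v' \<in> tips g (n - j))))" for a k j v v'
    using det[of a j v v'] det_q[of k j v v'] unfolding determined_def by metis
  have q_bound: "\<bar>?q \<omega> k j v v'\<bar> \<le> \<bar>p_pow k * p_lag j\<bar>" for \<omega> k j v v'
  proof (cases "v \<in> tips (W \<omega>) (n - j)")
    case True
    then have pos: "0 < num_tips (W \<omega>) (n - j)"
      by (auto simp: num_tips_def card_gt_0_iff)
    then have "1 \<le> real (num_tips (W \<omega>) (n - j))" by linarith
    then have "1 \<le> (real (num_tips (W \<omega>) (n - j)))\<^sup>2" by (rule one_le_power)
    then have "\<bar>p_pow k * p_lag j\<bar> / (real (num_tips (W \<omega>) (n - j)))\<^sup>2 \<le> \<bar>p_pow k * p_lag j\<bar> / 1"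
      using pos by (intro divide_left_mono) auto
    then show ?thesis by (auto simp: abs_mult)
  qed simp
  have int_q: "integrable P (\<lambda>\<omega>. \<psi> (W \<omega>) a j v v' * ?q \<omega> k j v v')" for a k j v v'
  proof (rule integrable_const_bound[where B = "B * \<bar>p_pow k * p_lag j\<bar>"])
    show "AE \<omega> in P. norm (\<psi> (W \<omega>) a j v v' * ?q \<omega> k j v v') \<le> B * \<bar>p_pow k * p_lag j\<bar>"
    proof (rule AE_I2)
      fix \<omega>
      \<comment> \<open>Any instance of the bound will do, hence the arbitrary arguments.\<close>
      have "0 \<le> B" using bound[of undefined] by (meson abs_ge_zero order_trans)
      then show "norm (\<psi> (W \<omega>) a j v v' * ?q \<omega> k j v v') \<le> B * \<bar>p_pow k * p_lag j\<bar>"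
        unfolding real_norm_def abs_mult[of "\<psi> (W \<omega>) a j v v'"]
        by (intro mult_mono bound q_bound) auto
    qed
  qed (rule borel_measurable_determined(2)[OF det_\<psi>q])
  \<comment> \<open>The weights vanish unless both \<open>v\<close> and \<open>v'\<close> are tips
    at the lagged time, and all those tips are below \<open>n\<close>.\<close>
  have pointwise: "(\<Sum>k\<in>{1..M}. \<Sum>j\<in>I. \<Sum>v<n. \<Sum>v'<n. \<psi> (W \<omega>) (h k) j v v' * ?q \<omega> k j v v') = ?rhs \<omega>" for \<omega>
  proof (intro refl sum.cong)
    fix k j
    let ?T = "tips (W \<omega>) (n - j)"
    let ?c = "p_pow k * p_lag j / (real (card ?T))\<^sup>2"
    have T: "?T \<subseteq> {..<n}"
      using n by (auto simp: in_tips_iff vertices_eq)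
    have "(\<Sum>v<n. \<Sum>v'<n. \<psi> (W \<omega>) (h k) j v v' * ?q \<omega> k j v v') =
        (\<Sum>v\<in>?T. \<Sum>v'<n. \<psi> (W \<omega>) (h k) j v v' * ?q \<omega> k j v v')"
      by (rule sum.mono_neutral_right) (use T in auto)
    also have "\<dots> = (\<Sum>v\<in>?T. \<Sum>v'\<in>?T. \<psi> (W \<omega>) (h k) j v v' * ?q \<omega> k j v v')"
      by (intro sum.cong refl sum.mono_neutral_right) (use T in auto)
    also have "\<dots> = (\<Sum>v\<in>?T. \<Sum>v'\<in>?T. \<psi> (W \<omega>) (h k) j v v' * ?c)"
      by (intro sum.cong refl) (simp add: num_tips_def)
    also have "\<dots> = (\<Sum>v\<in>?T. \<Sum>v'\<in>?T. \<psi> (W \<omega>) (h k) j v v') * ?c"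
      by (simp only: sum_distrib_right)
    also have "\<dots> = p_pow k * p_lag j *
       ((\<Sum>v\<in>?T. \<Sum>v'\<in>?T. \<psi> (W \<omega>) (h k) j v v') / (real (card ?T))\<^sup>2)"
      by (simp only: times_divide_eq_right times_divide_eq_left mult.commute)
    finally show "(\<Sum>v<n. \<Sum>v'<n. \<psi> (W \<omega>) (h k) j v v' * ?q \<omega> k j v v') = p_pow k * p_lag j *
       ((\<Sum>v\<in>?T. \<Sum>v'\<in>?T. \<psi> (W \<omega>) (h k) j v v') / (real (card ?T))\<^sup>2)" .
  qed
  have "?lhs = (\<integral>\<omega>. (\<Sum>k\<in>{1..M}. \<Sum>j\<in>I. \<Sum>v<n. \<Sum>v'<n.
      \<psi> (W \<omega>) (h k) j v v' * indicator (arrival n (h k) j v v') \<omega>) \<partial>P)"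
  proof (rule integral_cong_AE)
    have "determined n (\<lambda>g. \<psi> g (pow_time g n) (lag g n) (parent1 g n) (parent2 g n))"
      unfolding determined_def
    proof (intro allI impI)
      fix g g' assume a: "agree n g g'"
      have "agree (n - 1) g g'" by (rule agree_mono[OF a]) simp
      with det have "\<psi> g a j v v' = \<psi> g' a j v v'" for a j v v' unfolding determined_def by blast
      then show "\<psi> g (pow_time g n) (lag g n) (parent1 g n) (parent2 g n) =
          \<psi> g' (pow_time g' n) (lag g' n) (parent1 g' n) (parent2 g' n)"
        using agree_at[OF a n] by simp
    qed
    then show "(\<lambda>\<omega>. \<psi> (W \<omega>) (pow_time (W \<omega>) n) (lag (W \<omega>) n) (parent1 (W \<omega>) n) (parent2 (W \<omega>) n))
        \<in> borel_measurable P" by (rule borel_measurable_determined(2))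
    show "(\<lambda>\<omega>. \<Sum>k\<in>{1..M}. \<Sum>j\<in>I. \<Sum>v<n. \<Sum>v'<n.
      \<psi> (W \<omega>) (h k) j v v' * indicator (arrival n (h k) j v v') \<omega>) \<in> borel_measurable P"
      by (intro borel_measurable_sum borel_measurable_times borel_measurable_indicator
          borel_measurable_determined(2)[OF det] sets_arrival n)
    show "AE \<omega> in P. \<psi> (W \<omega>) (pow_time (W \<omega>) n) (lag (W \<omega>) n) (parent1 (W \<omega>) n) (parent2 (W \<omega>) n)
      = (\<Sum>k\<in>{1..M}. \<Sum>j\<in>I. \<Sum>v<n. \<Sum>v'<n.
      \<psi> (W \<omega>) (h k) j v v' * indicator (arrival n (h k) j v v') \<omega>)"
      using AE_tangle_run
    proof (rule AE_mp, intro AE_I2 impI)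
      fix \<omega> assume \<omega>: "\<omega> \<in> space P" and "tangle_run (W \<omega>) (h 1) hM emin"
      then interpret tangle_run "W \<omega>" "h 1" hM emin by simp
      let ?g = "W \<omega>"
      obtain k0 where k0: "k0 \<in> {1..M}" "pow_time ?g n = h k0" using pow_time_range[OF n \<omega>] by auto
      have j0: "lag ?g n \<in> I" by (rule lag_range[OF n \<omega>])
      note less = parents_less[OF n]
      \<comment> \<open>Since \<open>h\<close> is injective on its index range, the duration
        determines \<open>k\<close>, and exactly one summand survives.\<close>
      have inj: "h k = h k0 \<longleftrightarrow> k = k0" if "k \<in> {1..M}" for k
        using strict_mono_on_imp_inj_on[OF h_increasing] that k0(1) by (auto dest: inj_onD)
      have "\<psi> ?g (h k) j v v' * indicator (arrival n (h k) j v v') \<omega> =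
         (if v' = parent2 ?g n then if v = parent1 ?g n then if j = lag ?g n then if k = k0
           then \<psi> ?g (h k0) j v v' else 0 else 0 else 0 else 0)" if "k \<in> {1..M}" for k j v v'
        using inj[OF that] k0(2) \<omega> by (auto simp: arrival_def indicator_def)
      then have "(\<Sum>k\<in>{1..M}. \<Sum>j\<in>I. \<Sum>v<n. \<Sum>v'<n.
          \<psi> ?g (h k) j v v' * indicator (arrival n (h k) j v v') \<omega>) =
        (\<Sum>k\<in>{1..M}. \<Sum>j\<in>I. \<Sum>v<n. \<Sum>v'<n.
         (if v' = parent2 ?g n then if v = parent1 ?g n then if j = lag ?g n then if k = k0
           then \<psi> ?g (h k0) j v v' else 0 else 0 else 0 else 0))"
        by simp
      also have "\<dots> = \<psi> ?g (h k0) (lag ?g n) (parent1 ?g n) (parent2 ?g n)"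
        using k0(1) j0 less I_finite by simp
      finally show "\<psi> ?g (pow_time ?g n) (lag ?g n) (parent1 ?g n) (parent2 ?g n)
      = (\<Sum>k\<in>{1..M}. \<Sum>j\<in>I. \<Sum>v<n. \<Sum>v'<n.
          \<psi> ?g (h k) j v v' * indicator (arrival n (h k) j v v') \<omega>)" using k0(2) by simp
    qed
  qed
  also have "\<dots> = (\<Sum>k\<in>{1..M}. \<Sum>j\<in>I. \<Sum>v<n. \<Sum>v'<n.
      (\<integral>\<omega>. \<psi> (W \<omega>) (h k) j v v' * indicator (arrival n (h k) j v v') \<omega> \<partial>P))"
    by (simp only: Bochner_Integration.integral_sum Bochner_Integration.integrable_sum integrable_arrival[OF n det bound])
  also have "\<dots> = (\<Sum>k\<in>{1..M}. \<Sum>j\<in>I. \<Sum>v<n. \<Sum>v'<n. (\<integral>\<omega>. \<psi> (W \<omega>) (h k) j v v' * ?q \<omega> k j v v' \<partial>P))"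
    by (intro sum.cong refl integral_arrival[OF n _ _ det bound])
  also have "\<dots> = (\<integral>\<omega>. (\<Sum>k\<in>{1..M}. \<Sum>j\<in>I. \<Sum>v<n. \<Sum>v'<n. \<psi> (W \<omega>) (h k) j v v' * ?q \<omega> k j v v') \<partial>P)"
    by (simp only: Bochner_Integration.integral_sum Bochner_Integration.integrable_sum int_q)
  finally show "?lhs = (\<integral>\<omega>. ?rhs \<omega> \<partial>P)" unfolding pointwise .
  have "integrable P (\<lambda>\<omega>. \<Sum>k\<in>{1..M}. \<Sum>j\<in>I. \<Sum>v<n. \<Sum>v'<n. \<psi> (W \<omega>) (h k) j v v' * ?q \<omega> k j v v')"
    by (intro Bochner_Integration.integrable_sum int_q)
  then show "integrable P ?rhs" unfolding pointwise .
qed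

end

section \<open>Drift of the number of unreferenced vertices\<close>

context tangle_model
begin

text \<open>Turns an almost sure lower bound on the one-step conditional mean into one on
  expectations; it serves both the drift estimate and the probability of a stage.\<close>

lemma expectation_arrival_ge:
  fixes \<psi> :: "realisation \<Rightarrow> nat \<Rightarrow> nat \<Rightarrow> nat \<Rightarrow> nat \<Rightarrow> real"
  assumes n: "1 \<le> n" and det: "\<And>a j v v'. determined (n - 1) (\<lambda>g. \<psi> g a j v v')"
    and bound: "\<And>g a j v v'. \<bar>\<psi> g a j v v'\<bar> \<le> B"
    and S: "determined (n - 1) S"
    and ge: "AE \<omega> in P. c * of_bool (S (W \<omega>)) \<le> (\<Sum>k\<in>{1..M}. \<Sum>j\<in>I. p_pow k * p_lag j *
       ((\<Sum>v\<in>tips (W \<omega>) (n - j). \<Sum>v'\<in>tips (W \<omega>) (n - j). \<psi> (W \<omega>) (h k) j v v') /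
         (real (card (tips (W \<omega>) (n - j))))\<^sup>2))"
  shows "c * prob {\<omega> \<in> space P. S (W \<omega>)} \<le>
    (\<integral>\<omega>. \<psi> (W \<omega>) (pow_time (W \<omega>) n) (lag (W \<omega>) n) (parent1 (W \<omega>) n) (parent2 (W \<omega>) n) \<partial>P)"
proof -
  have "c * prob {\<omega> \<in> space P. S (W \<omega>)} = (\<integral>\<omega>. c * of_bool (S (W \<omega>)) \<partial>P)"
    using prob_determined[OF S] by simp
  also have "\<dots> \<le> (\<integral>\<omega>. (\<Sum>k\<in>{1..M}. \<Sum>j\<in>I. p_pow k * p_lag j *
       ((\<Sum>v\<in>tips (W \<omega>) (n - j). \<Sum>v'\<in>tips (W \<omega>) (n - j). \<psi> (W \<omega>) (h k) j v v') /
         (real (card (tips (W \<omega>) (n - j))))\<^sup>2)) \<partial>P)"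
  proof (rule integral_mono_AE[OF _ expectation_arrival(2)[OF n det bound] ge])
    have "determined (n - 1) (\<lambda>g. c * of_bool (S g))" using S by (simp add: determined_def)
    then show "integrable P (\<lambda>\<omega>. c * of_bool (S (W \<omega>)))"
      by (rule integrable_determined[where B = "\<bar>c\<bar>"]) simp
  qed
  also have "\<dots> = (\<integral>\<omega>. \<psi> (W \<omega>) (pow_time (W \<omega>) n) (lag (W \<omega>) n) (parent1 (W \<omega>) n) (parent2 (W \<omega>) n) \<partial>P)"
    by (rule expectation_arrival(1)[OF n det bound, symmetric])
  finally show ?thesis .
qed

lemma sum_weights: "(\<Sum>k\<in>{1..M}. \<Sum>j\<in>I. p_pow k * p_lag j * c) = c"
  using p_pow_sum p_lag_sum by (simp add: sum_distrib_left[symmetric] sum_distrib_right[symmetric])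

text \<open>This is \<open>1 - (2 * d + 1) / L\<close> for \<open>d = 2 * (hM + emax)\<close>, the
  largest possible number of already referenced tips, and \<open>L = 2 * d + 2\<close>.\<close>

definition drift :: real where
  "drift = 1 / (4 * real hM + 4 * real emax + 2)"

lemma drift_pos: "0 < drift"
  by (simp add: drift_def add_nonneg_pos)

text \<open>The lower bound on \<open>b\<close> leaves at least \<open>4 * hM + 4 * emax + 2\<close>
  tips at every lagged time, of which at most \<open>2 * (hM + emax)\<close> have been referenced
  meanwhile. Two uniform picks then hit more than one unreferenced vertex on average.\<close>

lemma referenced_tips_ge:
  assumes b: "10 * real (h M) - 6 * real (h 1) + 3 * real M * real (Max I) + 2 < b"
    and n: "1 \<le> n" and S: "determined (n - 1) S" and big: "\<And>g. S g \<Longrightarrow> b < real (num_tips g n)"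
  shows "(1 + drift) * prob {\<omega> \<in> space P. S (W \<omega>)} \<le>
    (\<integral>\<omega>. of_bool (S (W \<omega>)) * real (card ({parent1 (W \<omega>) n, parent2 (W \<omega>) n} \<inter> unreferenced (W \<omega>) n)) \<partial>P)"
proof -
  define \<psi> :: "realisation \<Rightarrow> nat \<Rightarrow> nat \<Rightarrow> nat \<Rightarrow> nat \<Rightarrow> real" where
    "\<psi> g a j v v' = of_bool (S g) * real (card ({v, v'} \<inter> unreferenced g n))" for g a j v v'
  have det: "determined (n - 1) (\<lambda>g. \<psi> g a j v v')" for a j v v'
    using S agree_unreferenced[of "n - 1" _ _ n] n unfolding determined_def \<psi>_def by auto
  have bound: "\<bar>\<psi> g a j v v'\<bar> \<le> 2" for g a j v v'
  proof -
    have "card ({v, v'} \<inter> unreferenced g n) \<le> card {v, v'}" by (rule card_mono) auto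
    also have "\<dots> \<le> 2" by (simp add: card_insert_if)
    finally show ?thesis by (simp add: \<psi>_def)
  qed
  have "AE \<omega> in P. (1 + drift) * of_bool (S (W \<omega>)) \<le> (\<Sum>k\<in>{1..M}. \<Sum>j\<in>I. p_pow k * p_lag j *
       ((\<Sum>v\<in>tips (W \<omega>) (n - j). \<Sum>v'\<in>tips (W \<omega>) (n - j). \<psi> (W \<omega>) (h k) j v v') /
         (real (card (tips (W \<omega>) (n - j))))\<^sup>2))"
    using AE_tangle_run
  proof (rule AE_mp, intro AE_I2 impI)
    fix \<omega> assume "tangle_run (W \<omega>) (h 1) hM emin"
    then interpret tangle_run "W \<omega>" "h 1" hM emin .
    let ?F = "unreferenced (W \<omega>) n" and ?T = "\<lambda>j. tips (W \<omega>) (n - j)"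
    show "(1 + drift) * of_bool (S (W \<omega>)) \<le> (\<Sum>k\<in>{1..M}. \<Sum>j\<in>I. p_pow k * p_lag j *
       ((\<Sum>v\<in>?T j. \<Sum>v'\<in>?T j. \<psi> (W \<omega>) (h k) j v v') / (real (card (?T j)))\<^sup>2))"
    proof (cases "S (W \<omega>)")
      case False
      then show ?thesis by (simp add: \<psi>_def)
    next
      case True
      have "1 + drift \<le> (\<Sum>v\<in>?T j. \<Sum>v'\<in>?T j. real (card ({v, v'} \<inter> ?F))) / (real (card (?T j)))\<^sup>2"
        if j: "j \<in> I" for j
      proof -
        let ?L = "real (card (?T j))"
        \<comment> \<open>With \<open>M \<ge> 2\<close> the term \<open>3 * M * emax\<close> is at
          least \<open>6 * emax\<close>; subtracting \<open>hM - h1 + j\<close> and using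
          \<open>h1 \<le> hM\<close> then gives the claimed number of tips.\<close>
        have "2 * real emax \<le> real M * real emax" using M_ge_2 by (intro mult_right_mono) auto
        then have "10 * real hM - 6 * real (h 1) + 6 * real emax + 2 < real (num_tips (W \<omega>) n)"
          using b big[OF True] by linarith
        moreover have "real (num_tips (W \<omega>) n) \<le> ?L + (real hM - real (h 1) + real j)"
          using num_tips_le_earlier[of n j] h1_le_hM unfolding num_tips_def by linarith
        moreover have je: "real j \<le> real emax" using lag_bounds(2)[OF j] by simp
        moreover have "real (h 1) \<le> real hM" using h1_le_hM by simp
        ultimately have L: "4 * real hM + 4 * real emax + 2 \<le> ?L" by linarith
        then have L0: "0 < ?L" by linarith
        have "(2 * real (2 * (hM + j)) + 1) / ?L \<le> (4 * real hM + 4 * real emax + 1) / ?L"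
          using je L0 by (intro divide_right_mono) auto
        also have "\<dots> \<le> (4 * real hM + 4 * real emax + 1) / (4 * real hM + 4 * real emax + 2)"
          using L by (intro divide_left_mono) (auto intro!: mult_pos_pos add_nonneg_pos)
        also have "\<dots> = 1 - drift"
          by (simp add: drift_def field_simps add_nonneg_pos)
        finally have "1 + drift \<le> 2 - (2 * real (2 * (hM + j)) + 1) / ?L" by linarith
        also have "\<dots> \<le> (\<Sum>v\<in>?T j. \<Sum>v'\<in>?T j. real (card ({v, v'} \<inter> ?F))) / ?L\<^sup>2"
          by (rule sum_card_pair_Int_ge)
            (use tips_nonempty card_tips_diff_unreferenced[OF n] in auto)
        finally show ?thesis .
      qed
      then have "(\<Sum>k\<in>{1..M}. \<Sum>j\<in>I. p_pow k * p_lag j * (1 + drift)) \<le>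
        (\<Sum>k\<in>{1..M}. \<Sum>j\<in>I. p_pow k * p_lag j *
          ((\<Sum>v\<in>?T j. \<Sum>v'\<in>?T j. real (card ({v, v'} \<inter> ?F))) / (real (card (?T j)))\<^sup>2))"
        using p_pow_pos p_lag_pos by (intro sum_mono mult_left_mono) (auto intro: less_imp_le)
      then show ?thesis using True unfolding sum_weights by (simp add: \<psi>_def)
    qed
  qed
  from expectation_arrival_ge[OF n det bound S this] show ?thesis by (simp add: \<psi>_def)
qed

text \<open>On the event that there are more than \<open>b\<close> tips throughout
  \<open>N..n\<close>, the expected number of unreferenced vertices falls at each step by at least
  \<open>drift\<close> times the probability of that event. As it stays nonnegative, the event of
  always exceeding \<open>b\<close> must be null.\<close>

lemma AE_num_tips_le:
  assumes b: "10 * real (h M) - 6 * real (h 1) + 3 * real M * real (Max I) + 2 < b"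
    and N: "1 \<le> N"
  shows "AE \<omega> in P. \<exists>m\<ge>N. real (num_tips (W \<omega>) m) \<le> b"
proof -
  define S where "S n g \<longleftrightarrow> (\<forall>m. N \<le> m \<and> m \<le> n \<longrightarrow> b < real (num_tips g m))" for n g
  define R where "R n g = real (card (unreferenced g n))" for n g
  \<comment> \<open>The tips at time \<open>n\<close> depend only on arrivals up to
    \<open>n - 1\<close>, so conditioning at step \<open>n\<close> is legitimate.\<close>
  have det_S: "determined (n - 1) (S n)" for n
    using agree_tips[of "n - 1"] unfolding determined_def S_def num_tips_def by force
  have det_R: "determined (n - 1) (R n)" for n
    using agree_unreferenced[of "n - 1" _ _ n] unfolding determined_def R_def by simp
  have R_le: "R n g \<le> real n" for n g
    unfolding R_def using card_unreferenced_le[of g n] by simp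
  have R_ge: "0 \<le> R n g" for n g by (simp add: R_def)
  have det_mono: "determined k f" if "determined l f" "l \<le> k" for k l and f :: "realisation \<Rightarrow> 'c"
    using that agree_mono unfolding determined_def by blast
  have int: "integrable P (\<lambda>\<omega>. of_bool (S n (W \<omega>)) * R m (W \<omega>))" for n m
  proof (rule integrable_determined[where B = "real m"])
    show "determined (max (n - 1) (m - 1)) (\<lambda>g. of_bool (S n g) * R m g)"
      using det_mono[OF det_S[of n], of "max (n - 1) (m - 1)"]
        det_mono[OF det_R[of m], of "max (n - 1) (m - 1)"]
      unfolding determined_def by auto
    show "\<bar>of_bool (S n g) * R m g\<bar> \<le> real m" for g
      using R_le[of m g] R_ge[of m g] by auto
  qed
  define A where "A n = (\<integral>\<omega>. of_bool (S n (W \<omega>)) * R n (W \<omega>) \<partial>P)" for n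
  let ?p = "\<lambda>n. prob {\<omega> \<in> space P. S n (W \<omega>)}"
  have step: "A (Suc n) \<le> A n - drift * ?p n" if n: "N \<le> n" for n
  proof -
    have n1: "1 \<le> n" using N n by simp
    let ?X = "\<lambda>g. real (card ({parent1 g n, parent2 g n} \<inter> unreferenced g n))"
    have detX: "determined n (\<lambda>g. of_bool (S n g) * ?X g)"
      using det_mono[OF det_S[of n], of n] agree_unreferenced[of n _ _ n] agree_at[of n _ _ n] n1
      unfolding determined_def by auto
    have X2: "?X g \<le> 2" for g
    proof -
      have "card ({parent1 g n, parent2 g n} \<inter> unreferenced g n) \<le> card {parent1 g n, parent2 g n}"
        by (rule card_mono) auto
      also have "\<dots> \<le> 2" by (simp add: card_insert_if)
      finally show ?thesis by simp
    qed
    have intX: "integrable P (\<lambda>\<omega>. of_bool (S n (W \<omega>)) * ?X (W \<omega>))"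
      by (rule integrable_determined[OF detX, where B = 2]) (use X2 in auto)
    have intS: "integrable P (\<lambda>\<omega>. of_bool (S n (W \<omega>)) :: real)"
      by (rule integrable_determined[where B = 1 and n = "n - 1"])
        (use det_S[of n] in \<open>auto simp: determined_def\<close>)
    \<comment> \<open>The events \<open>S n\<close> decrease in \<open>n\<close> and
      \<open>R\<close> is nonnegative, so the larger event may be kept.\<close>
    have "A (Suc n) \<le> (\<integral>\<omega>. of_bool (S n (W \<omega>)) * R (Suc n) (W \<omega>) \<partial>P)"
      unfolding A_def
      by (rule integral_mono[OF int int]) (use R_ge in \<open>auto simp: S_def\<close>)
    also have "\<dots> = (\<integral>\<omega>. of_bool (S n (W \<omega>)) * R n (W \<omega>) + of_bool (S n (W \<omega>))
        - of_bool (S n (W \<omega>)) * ?X (W \<omega>) \<partial>P)"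
    proof (rule integral_cong_AE)
      show "AE \<omega> in P. of_bool (S n (W \<omega>)) * R (Suc n) (W \<omega>) =
        of_bool (S n (W \<omega>)) * R n (W \<omega>) + of_bool (S n (W \<omega>)) - of_bool (S n (W \<omega>)) * ?X (W \<omega>)"
        using AE_tangle_run
      proof (rule AE_mp, intro AE_I2 impI)
        fix \<omega> assume "tangle_run (W \<omega>) (h 1) hM emin"
        then interpret tangle_run "W \<omega>" "h 1" hM emin .
        have "R (Suc n) (W \<omega>) + ?X (W \<omega>) = R n (W \<omega>) + 1"
          using card_unreferenced_Suc[OF n1] unfolding R_def by linarith
        then show "of_bool (S n (W \<omega>)) * R (Suc n) (W \<omega>) =
          of_bool (S n (W \<omega>)) * R n (W \<omega>) + of_bool (S n (W \<omega>)) - of_bool (S n (W \<omega>)) * ?X (W \<omega>)"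
          by (cases "S n (W \<omega>)") simp_all
      qed
    qed (use int[of n n] int[of n "Suc n"] intX intS in
        \<open>auto intro!: borel_measurable_integrable Bochner_Integration.integrable_diff Bochner_Integration.integrable_add\<close>)
    also have "\<dots> = A n + ?p n - (\<integral>\<omega>. of_bool (S n (W \<omega>)) * ?X (W \<omega>) \<partial>P)"
      unfolding A_def using int[of n n] intX intS prob_determined[OF det_S[of n]] by simp
    also have "\<dots> \<le> A n + ?p n - (1 + drift) * ?p n"
      using referenced_tips_ge[OF b n1 det_S] n by (auto simp: S_def)
    finally show ?thesis by (simp add: algebra_simps)
  qed
  let ?Z = "{\<omega> \<in> space P. \<forall>m\<ge>N. b < real (num_tips (W \<omega>) m)}"
  have Z_sets: "?Z \<in> sets P"
  proof -
    have "?Z = {\<omega> \<in> space P. \<forall>n. S n (W \<omega>)}" by (auto simp: S_def)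
    also have "\<dots> \<in> sets P" by (intro sets.sets_Collect_countable_All sets_determined[OF det_S])
    finally show ?thesis .
  qed
  have A_le: "A (N + k) \<le> A N - drift * real k * prob ?Z" for k
  proof (induction k)
    case (Suc k)
    have "prob ?Z \<le> ?p (N + k)"
      by (rule finite_measure_mono) (auto simp: S_def sets_determined[OF det_S[of "N + k", unfolded S_def]])
    then have "drift * prob ?Z \<le> drift * ?p (N + k)" using drift_pos by simp
    then show ?case using step[of "N + k"] Suc by (simp add: algebra_simps)
  qed simp
  have A_nonneg: "0 \<le> A n" for n
    unfolding A_def by (rule integral_nonneg_AE) (use R_ge in auto)
  have bounded: "real k * (drift * prob ?Z) \<le> A N" for k
    using A_le[of k] A_nonneg[of "N + k"] by (simp add: algebra_simps)
  have "drift * prob ?Z \<le> 0"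
  proof (rule ccontr)
    assume "\<not> drift * prob ?Z \<le> 0"
    then have "0 < drift * prob ?Z" by (simp only: not_le)
    from ex_less_of_nat_mult[OF this, of "A N"]
    obtain k where "A N < real k * (drift * prob ?Z)" by blast
    then show False using bounded[of k] by simp
  qed
  then have "prob ?Z \<le> 0"
    using drift_pos by (simp only: mult_le_0_iff) linarith
  then have "prob ?Z = 0"
    using measure_nonneg[of P ?Z] by linarith
  then have "AE \<omega> in P. \<omega> \<notin> ?Z"
    by (simp only: prob_eq_0[OF Z_sets])
  then show ?thesis
    by (rule AE_mp) (auto simp: not_less)
qed

end

section \<open>Probability of bottlenecks\<close>

context tangle_model
begin

text \<open>A lower bound for the conditional probability of one prescribed arrival: longest
  duration, shortest lag, and one admissible pair of parents. The squared base bounds the number of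
  lagged tips up to \<open>K\<close> steps after a time with at most \<open>b\<close> tips.\<close>

definition stage_weight :: "real \<Rightarrow> nat \<Rightarrow> real" where
  "stage_weight b K = p_pow M * p_lag emin / (b + 3 * real hM + real K + real emin + 1)\<^sup>2"

lemma stage_weight_pos:
  assumes "0 \<le> b" shows "0 < stage_weight b K"
proof -
  have "0 < b + 3 * real hM + real K + real emin + 1" using assms by simp
  then show ?thesis
    unfolding stage_weight_def using p_pow_pos[of M] p_lag_pos[OF lag_bounds(3)] M_ge_2
    by (intro divide_pos_pos mult_pos_pos) auto
qed

text \<open>On the current stage some admissible pair of tips exists, and a single pair already has
  the required conditional probability. The event \<open>C\<close>, decided before arrival
  \<open>i\<close>, leaves room for the extra condition in the final argument.\<close>

lemma prob_stage_Suc_ge: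
  assumes i: "1 \<le> i" "i \<le> m" "m \<le> i + K" and b: "0 \<le> b"
    and C: "determined (i - 1) C" "\<And>g. C g \<Longrightarrow> real (num_tips g i) \<le> b"
    and kA: "hM + emin \<le> kA"
    and free: "AE \<omega> in P. real (num_tips (W \<omega>) i) \<le> b \<and> event_A hM emin kA (W \<omega>) i \<longrightarrow>
      3 * (hM + emin) < num_free_tips (W \<omega>) (i + kA)"
  shows "stage_weight b K * prob {\<omega> \<in> space P. C (W \<omega>) \<and> stage hM emin kA (W \<omega>) i m}
    \<le> prob {\<omega> \<in> space P. C (W \<omega>) \<and> stage hM emin kA (W \<omega>) i (Suc m)}"
proof -
  have m: "1 \<le> m" using i by simp
  let ?S = "\<lambda>g. C g \<and> stage hM emin kA g i m"
  define \<psi> :: "realisation \<Rightarrow> nat \<Rightarrow> nat \<Rightarrow> nat \<Rightarrow> nat \<Rightarrow> real" where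
    "\<psi> g a j v v' = of_bool (?S g \<and> a = hM \<and> j = emin \<and> allowed_parents hM emin kA g i m v v')"
    for g a j v v'
  have C_eq: "C g = C g'" if "agree (m - 1) g g'" for g g'
    using determinedD[OF C(1) agree_mono[OF that]] i by simp
  have S: "determined (m - 1) ?S"
    unfolding determined_def using C_eq agree_stage[OF _ i(1), of "m - 1" _ _ m] by auto
  have det: "determined (m - 1) (\<lambda>g. \<psi> g a j v v')" for a j v v'
    unfolding determined_def
  proof (intro allI impI)
    fix g g' assume a: "agree (m - 1) g g'"
    have "allowed_parents hM emin kA g i m v v' = allowed_parents hM emin kA g' i m v v'"
      by (rule agree_allowed_parents[OF a]) simp
    then show "\<psi> g a j v v' = \<psi> g' a j v v'"
      using determinedD[OF S a] by (simp add: \<psi>_def)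
  qed
  have bound: "\<bar>\<psi> g a j v v'\<bar> \<le> 1" for g a j v v' by (simp add: \<psi>_def)
  have "AE \<omega> in P. stage_weight b K * of_bool (?S (W \<omega>)) \<le> (\<Sum>k\<in>{1..M}. \<Sum>j\<in>I. p_pow k * p_lag j *
       ((\<Sum>v\<in>tips (W \<omega>) (m - j). \<Sum>v'\<in>tips (W \<omega>) (m - j). \<psi> (W \<omega>) (h k) j v v') /
         (real (card (tips (W \<omega>) (m - j))))\<^sup>2))"
    using AE_tangle_run free
  proof eventually_elim
    fix \<omega> assume "tangle_run (W \<omega>) (h 1) hM emin"
      and F: "real (num_tips (W \<omega>) i) \<le> b \<and> event_A hM emin kA (W \<omega>) i \<longrightarrow>
        3 * (hM + emin) < num_free_tips (W \<omega>) (i + kA)"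
    then interpret tangle_run "W \<omega>" "h 1" hM emin by simp
    let ?T = "\<lambda>j. tips (W \<omega>) (m - j)"
    let ?t = "\<lambda>k j. p_pow k * p_lag j *
       ((\<Sum>v\<in>?T j. \<Sum>v'\<in>?T j. \<psi> (W \<omega>) (h k) j v v') / (real (card (?T j)))\<^sup>2)"
    have t_nonneg: "0 \<le> ?t k j" if "k \<in> {1..M}" "j \<in> I" for k j
      using p_pow_pos[OF that(1)] p_lag_pos[OF that(2)]
      by (intro mult_nonneg_nonneg divide_nonneg_nonneg sum_nonneg) (auto simp: \<psi>_def)
    show "stage_weight b K * of_bool (?S (W \<omega>)) \<le> (\<Sum>k\<in>{1..M}. \<Sum>j\<in>I. ?t k j)"
    proof (cases "?S (W \<omega>)")
      case False
      have "0 \<le> (\<Sum>k\<in>{1..M}. \<Sum>j\<in>I. ?t k j)" by (intro sum_nonneg t_nonneg)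
      then show ?thesis by (simp only: False of_bool_eq mult_zero_right)
    next
      case True
      then have tips_b: "real (num_tips (W \<omega>) i) \<le> b" using C(2) by blast
      obtain v v' where v: "v \<in> ?T emin" "v' \<in> ?T emin" "allowed_parents hM emin kA (W \<omega>) i m v v'"
        using allowed_parents_exist[of kA i m] True F tips_b i kA by blast
      then have "1 = \<psi> (W \<omega>) hM emin v v'" using True by (simp add: \<psi>_def)
      also have "\<dots> \<le> (\<Sum>v'\<in>?T emin. \<psi> (W \<omega>) hM emin v v')"
        by (rule member_le_sum) (use v in \<open>auto simp: \<psi>_def\<close>)
      also have "\<dots> \<le> (\<Sum>v\<in>?T emin. \<Sum>v'\<in>?T emin. \<psi> (W \<omega>) hM emin v v')"
        by (rule member_le_sum[of v _ "\<lambda>v. \<Sum>v'\<in>?T emin. \<psi> (W \<omega>) hM emin v v'"])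
          (use v in \<open>auto simp: \<psi>_def intro!: sum_nonneg\<close>)
      finally have sum: "1 \<le> (\<Sum>v\<in>?T emin. \<Sum>v'\<in>?T emin. \<psi> (W \<omega>) hM emin v v')" .
      have pos: "0 < real (card (?T emin))"
        using num_tips_pos[of "m - emin"] by (simp add: num_tips_def)
      have "real (card (?T emin)) \<le> b + 3 * real hM + real K + real emin + 1"
        using num_tips_bound[OF i(1,2), of emin] tips_b i(3) by (simp add: num_tips_def)
      then have "(real (card (?T emin)))\<^sup>2 \<le> (b + 3 * real hM + real K + real emin + 1)\<^sup>2"
        by (rule power_mono) simp
      then have "1 / (b + 3 * real hM + real K + real emin + 1)\<^sup>2 \<le>
          (\<Sum>v\<in>?T emin. \<Sum>v'\<in>?T emin. \<psi> (W \<omega>) hM emin v v') / (real (card (?T emin)))\<^sup>2"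
        using sum pos by (intro frac_le) auto
      \<comment> \<open>Only the term with duration \<open>hM\<close> and lag \<open>emin\<close> is
        kept; the others are nonnegative.\<close>
      then have "p_pow M * p_lag emin * (1 / (b + 3 * real hM + real K + real emin + 1)\<^sup>2) \<le> ?t M emin"
        using p_pow_pos[of M] p_lag_pos[OF lag_bounds(3)] M_ge_2
        by (intro mult_left_mono) auto
      also have "\<dots> \<le> (\<Sum>j\<in>I. ?t M j)"
        by (rule member_le_sum) (use lag_bounds(3) I_finite M_ge_2 t_nonneg in auto)
      also have "\<dots> \<le> (\<Sum>k\<in>{1..M}. \<Sum>j\<in>I. ?t k j)"
        by (rule member_le_sum[of M _ "\<lambda>k. \<Sum>j\<in>I. ?t k j"])
          (use M_ge_2 t_nonneg in \<open>auto intro!: sum_nonneg\<close>)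
      finally show ?thesis using True by (simp add: stage_weight_def)
    qed
  qed
  from expectation_arrival_ge[OF m det bound S this]
  have "stage_weight b K * prob {\<omega> \<in> space P. C (W \<omega>) \<and> stage hM emin kA (W \<omega>) i m} \<le>
    (\<integral>\<omega>. of_bool (C (W \<omega>) \<and> stage hM emin kA (W \<omega>) i (Suc m)) \<partial>P)"
    unfolding \<psi>_def stage_Suc[OF i(2)] by (simp only: conj_assoc)
  also have "\<dots> = prob {\<omega> \<in> space P. C (W \<omega>) \<and> stage hM emin kA (W \<omega>) i (Suc m)}"
  proof (rule prob_determined[of m])
    have "C g = C g'" if "agree m g g'" for g g'
      using C_eq[OF agree_mono[OF that]] by simp
    then show "determined m (\<lambda>g. C g \<and> stage hM emin kA g i (Suc m))"
      unfolding determined_def using agree_stage[OF _ i(1), of m _ _ "Suc m"] by auto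
  qed
  finally show ?thesis .
qed

lemma prob_stage_ge:
  assumes i: "1 \<le> i" and b: "0 \<le> b"
    and C: "determined (i - 1) C" "\<And>g. C g \<Longrightarrow> real (num_tips g i) \<le> b"
    and kA: "hM + emin \<le> kA"
    and free: "AE \<omega> in P. real (num_tips (W \<omega>) i) \<le> b \<and> event_A hM emin kA (W \<omega>) i \<longrightarrow>
      3 * (hM + emin) < num_free_tips (W \<omega>) (i + kA)"
    and k: "k \<le> Suc K"
  shows "stage_weight b K ^ k * prob {\<omega> \<in> space P. C (W \<omega>)}
    \<le> prob {\<omega> \<in> space P. C (W \<omega>) \<and> stage hM emin kA (W \<omega>) i (i + k)}"
  using k
proof (induction k)
  case (Suc k)
  have "stage_weight b K ^ Suc k * prob {\<omega> \<in> space P. C (W \<omega>)} \<le>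
      stage_weight b K * prob {\<omega> \<in> space P. C (W \<omega>) \<and> stage hM emin kA (W \<omega>) i (i + k)}"
    using Suc stage_weight_pos[OF b, of K] by simp
  also have "\<dots> \<le> prob {\<omega> \<in> space P. C (W \<omega>) \<and> stage hM emin kA (W \<omega>) i (Suc (i + k))}"
    by (rule prob_stage_Suc_ge[OF i _ _ b C kA free]) (use Suc in auto)
  finally show ?case by simp
qed simp

lemma AE_infinite_bottleneck:
  assumes b: "10 * real (h M) - 6 * real (h 1) + 3 * real M * real (Max I) + 2 < b"
    and kA: "hM + emin \<le> kA"
    and free: "\<And>i. 1 \<le> i \<Longrightarrow> AE \<omega> in P. real (num_tips (W \<omega>) i) \<le> b \<and> event_A hM emin kA (W \<omega>) i \<longrightarrow>
      3 * (hM + emin) < num_free_tips (W \<omega>) (i + kA)"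
  shows "AE \<omega> in P. infinite {i. 1 \<le> i \<and> bottleneck M hM emin emax b kA (W \<omega>) i}"
proof -
  have b0: "0 \<le> b"
  proof -
    have "0 \<le> 3 * real M * real emax" by simp
    moreover have "real (h 1) \<le> real hM" using h_bounds(1)[of M] M_ge_2 by simp
    ultimately show ?thesis using b by linarith
  qed
  let ?bn = "\<lambda>g i. bottleneck M hM emin emax b kA g i"
  define K where "K = nat \<lfloor>kappa_C M hM emin emax b kA\<rfloor>"
  have kC: "real (kappa_B emin kA) \<le> kappa_C M hM emin emax b kA"
    unfolding kappa_C_def by simp
  then have "0 \<le> kappa_C M hM emin emax b kA" by linarith
  then have K: "kappa_C M hM emin emax b kA < real K + 1" "real K \<le> kappa_C M hM emin emax b kA"
    unfolding K_def by linarith+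
  have KB: "kappa_B emin kA \<le> K" using kC K by linarith
  note bn_iff = bottleneck_iff_stage[OF K KB]
  have bn_eq: "?bn g i = ?bn g' i" if "agree n g g'" "1 \<le> i" "i + K \<le> n" for g g' i n
    using agree_tips[OF that(1), of i] agree_stage[OF that(1,2), of "Suc (i + K)"] that(3)
    unfolding bn_iff num_tips_def by simp
  define \<delta> where "\<delta> = stage_weight b K ^ Suc K"
  have \<delta>: "0 < \<delta>" unfolding \<delta>_def by (rule zero_less_power[OF stage_weight_pos[OF b0]])
  have "AE \<omega> in P. \<exists>i\<ge>N. ?bn (W \<omega>) i" if N: "1 \<le> N" for N
  proof -
    \<comment> \<open>The event \<open>D_i\<close> restricted to bottlenecks starting at
      \<open>N\<close> or later. One that starts at \<open>i'\<close> is completed by arrival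
      \<open>i' + K\<close>, so \<open>i' + K < i\<close> keeps the condition decidable from
      arrivals before \<open>i\<close>.\<close>
    define C where "C i g \<longleftrightarrow> real (num_tips g i) \<le> b \<and> (\<forall>i'. N \<le> i' \<and> i' + K < i \<longrightarrow> \<not> ?bn g i')" for i g
    have det: "determined (i - 1) (C i)" for i
      unfolding determined_def
    proof (intro allI impI)
      fix g g' assume a: "agree (i - 1) g g'"
      have "num_tips g i = num_tips g' i" using agree_tips[OF a, of i] by (simp add: num_tips_def)
      moreover have "?bn g i' = ?bn g' i'" if "N \<le> i'" "i' + K < i" for i'
        by (rule bn_eq[OF a]) (use that N in auto)
      ultimately show "C i g = C i g'" unfolding C_def by metis
    qed
    let ?C = "\<lambda>i. {\<omega> \<in> space P. C i (W \<omega>)}"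
    let ?H = "\<lambda>i. {\<omega> \<in> space P. C i (W \<omega>) \<and> ?bn (W \<omega>) i}"
    have H_sets: "?H i \<in> sets P" if "1 \<le> i" for i
    proof (rule sets_determined[of "i + K"])
      have "C i g = C i g'" if "agree (i + K) g g'" for g g'
        using determinedD[OF det[of i] agree_mono[OF that]] by simp
      then show "determined (i + K) (\<lambda>g. C i g \<and> ?bn g i)"
        unfolding determined_def using bn_eq[OF _ \<open>1 \<le> i\<close> order_refl] by blast
    qed
    have int_H: "integrable P (indicator (?H i) :: 'a \<Rightarrow> real)" if "1 \<le> i" for i
      by (rule integrable_real_indicator[OF H_sets[OF that]]) (simp add: less_top[symmetric])
    have CH: "\<delta> * prob (?C i) \<le> prob (?H i)" if i: "1 \<le> i" for i
    proof -
      have "\<delta> * prob (?C i) \<le> prob {\<omega> \<in> space P. C i (W \<omega>) \<and> stage hM emin kA (W \<omega>) i (i + Suc K)}"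
        unfolding \<delta>_def
        by (rule prob_stage_ge[OF i b0 det _ kA free[OF i] order_refl]) (simp add: C_def)
      also have "{\<omega> \<in> space P. C i (W \<omega>) \<and> stage hM emin kA (W \<omega>) i (i + Suc K)} = ?H i"
        unfolding bn_iff by (auto simp: C_def)
      finally show ?thesis .
    qed
    \<comment> \<open>If \<open>m\<close> is the first index in the sum whose event occurs, then
      \<open>C i\<close> fails for every \<open>i > m + K\<close>, so at most \<open>K + 1\<close>
      indices contribute.\<close>
    have few: "(\<Sum>i\<in>{N..<N + n}. indicator (?H i) \<omega>) \<le> real (Suc K)" for \<omega> n
    proof -
      let ?J = "{i \<in> {N..<N + n}. \<omega> \<in> ?H i}"
      have "card ?J \<le> Suc K"
      proof (cases "?J = {}")
        case False
        have fin: "finite ?J" by simp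
        obtain m where m: "m \<in> ?J" "\<And>i. i \<in> ?J \<Longrightarrow> m \<le> i"
          using Min_in[OF fin False] Min_le[OF fin] by blast
        have "?J \<subseteq> {m..m + K}"
        proof
          fix i assume i: "i \<in> ?J"
          then have "C i (W \<omega>)" by blast
          moreover have "N \<le> m" "?bn (W \<omega>) m" using m(1) by auto
          ultimately have "\<not> m + K < i" unfolding C_def by blast
          then show "i \<in> {m..m + K}" using m(2)[OF i] by simp
        qed
        then have "card ?J \<le> card {m..m + K}" by (intro card_mono) auto
        then show ?thesis by simp
      qed (simp only: card.empty le0)
      moreover have "(\<Sum>i\<in>{N..<N + n}. indicator (?H i) \<omega>) = real (card ?J)"
        by (simp add: indicator_def sum.If_cases Int_def)
      ultimately show ?thesis by linarith
    qed
    \<comment> \<open>The pathwise bound on the number of starts bounds the sum of their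
      probabilities, and each \<open>C i\<close> costs only a factor
      \<open>\<delta>\<close>.\<close>
    have "(\<Sum>i<n. prob (?C (i + N))) \<le> real (Suc K) / \<delta>" for n
    proof -
      have "\<delta> * (\<Sum>i<n. prob (?C (i + N))) \<le> (\<Sum>i<n. prob (?H (i + N)))"
        unfolding sum_distrib_left using CH N by (intro sum_mono) auto
      also have "\<dots> = (\<Sum>i\<in>{N..<N + n}. prob (?H i))"
        by (rule sum.reindex_bij_witness[of _ "\<lambda>i. i - N" "\<lambda>i. i + N"]) auto
      also have "\<dots> = (\<integral>\<omega>. (\<Sum>i\<in>{N..<N + n}. indicator (?H i) \<omega>) \<partial>P)"
      proof -
        have "(\<integral>\<omega>. (\<Sum>i\<in>{N..<N + n}. indicator (?H i) \<omega>) \<partial>P)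
            = (\<Sum>i\<in>{N..<N + n}. (\<integral>\<omega>. (indicator (?H i) \<omega> :: real) \<partial>P))"
          by (rule Bochner_Integration.integral_sum) (use int_H N in auto)
        also have "\<dots> = (\<Sum>i\<in>{N..<N + n}. prob (?H i))"
        proof (rule sum.cong[OF refl])
          fix i assume "i \<in> {N..<N + n}"
          have "?H i \<inter> space P = ?H i" by auto
          then show "(\<integral>\<omega>. (indicator (?H i) \<omega> :: real) \<partial>P) = prob (?H i)"
            by (simp only: Bochner_Integration.integral_indicator)
        qed
        finally show ?thesis by (rule sym)
      qed
      also have "\<dots> \<le> real (Suc K)"
      proof (rule integral_le_const)
        show "integrable P (\<lambda>\<omega>. \<Sum>i\<in>{N..<N + n}. (indicator (?H i) \<omega> :: real))"
          by (rule Bochner_Integration.integrable_sum) (use int_H N in auto)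
        show "AE \<omega> in P. (\<Sum>i\<in>{N..<N + n}. indicator (?H i) \<omega>) \<le> real (Suc K)"
          by (rule AE_I2) (rule few)
      qed
      finally show ?thesis using \<delta> by (simp add: pos_le_divide_eq mult.commute)
    qed
    then have "summable (\<lambda>i. prob (?C (i + N)))"
      by (intro summableI_nonneg_bounded[where x = "real (Suc K) / \<delta>"]) auto
    then have ev: "AE \<omega> in P. eventually (\<lambda>i. \<omega> \<in> space P - ?C (i + N)) sequentially"
      by (intro borel_cantelli_AE1) (use sets_determined[OF det] in \<open>auto simp: emeasure_eq_measure\<close>)
    have "AE \<omega> in P. \<forall>N'. 1 \<le> N' \<longrightarrow> (\<exists>m\<ge>N'. real (num_tips (W \<omega>) m) \<le> b)"
      unfolding AE_all_countable using AE_num_tips_le[OF b] by (auto intro: AE_impI)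
    \<comment> \<open>Eventually \<open>C i\<close> fails although \<open>num_tips\<close> is at
      most \<open>b\<close> infinitely often, so some bottleneck has been completed.\<close>
    then show ?thesis using ev
    proof eventually_elim
      fix \<omega> assume often: "\<forall>N'. 1 \<le> N' \<longrightarrow> (\<exists>m\<ge>N'. real (num_tips (W \<omega>) m) \<le> b)"
        and "eventually (\<lambda>i. \<omega> \<in> space P - ?C (i + N)) sequentially"
      then obtain m where m: "\<And>i. m \<le> i \<Longrightarrow> \<omega> \<in> space P - ?C (i + N)"
        by (auto simp: eventually_sequentially)
      obtain i where i: "m + N \<le> i" "real (num_tips (W \<omega>) i) \<le> b"
        using often[rule_format, of "m + N"] N by auto
      have "\<omega> \<in> space P - ?C (i - N + N)" by (rule m) (use i in simp)
      then have "\<not> C i (W \<omega>)" using i by auto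
      then show "\<exists>i\<ge>N. ?bn (W \<omega>) i" using i unfolding C_def by auto
    qed
  qed
  then have "AE \<omega> in P. \<forall>N. 1 \<le> N \<longrightarrow> (\<exists>i\<ge>N. ?bn (W \<omega>) i)"
    unfolding AE_all_countable by (auto intro: AE_impI)
  then show ?thesis
  proof (rule AE_mp, intro AE_I2 impI)
    fix \<omega> assume *: "\<forall>N. 1 \<le> N \<longrightarrow> (\<exists>i\<ge>N. ?bn (W \<omega>) i)"
    show "infinite {i. 1 \<le> i \<and> ?bn (W \<omega>) i}"
      unfolding infinite_nat_iff_unbounded_le
    proof
      fix m
      show "\<exists>n\<ge>m. n \<in> {i. 1 \<le> i \<and> ?bn (W \<omega>) i}"
        using *[rule_format, of "max 1 m"] by auto
    qed
  qed
qed

end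

theorem lemma3p18:
  fixes P :: "'a measure"
    and M :: nat
    and h :: "nat \<Rightarrow> nat"
    and p_pow :: "nat \<Rightarrow> real"
    and I :: "nat set"
    and p_lag :: "nat \<Rightarrow> real"
    and W :: "'a \<Rightarrow> realisation"
    and b :: real
    and kA :: nat
  assumes model: "tangle_model P M h p_pow I p_lag W"
    and b_large: "10 * real (h M) - 6 * real (h 1) + 3 * real M * real (Max I) + 2 < b"
    and kA_large: "1 + max (2 * real (h M))
                      (3 * real (h M) * (real (h M) + real (Min I)) / (real (h M) - 1)) < real kA"
    and kA_free: "\<And>i. 1 \<le> i \<Longrightarrow>
          AE \<omega> in P. real (num_tips (W \<omega>) i) \<le> b \<and> event_A (h M) (Min I) kA (W \<omega>) i \<longrightarrow>
            3 * (real (h M) + real (Min I))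
              < real (num_free_tips (W \<omega>) (i + kA)) - real (num_free_tips (W \<omega>) (i + h M))"
  shows "AE \<omega> in P. infinite {i. 1 \<le> i \<and> bottleneck M (h M) (Min I) (Max I) b kA (W \<omega>) i}"
proof -
  interpret tangle_model P M h p_pow I p_lag W by (rule model)
  \<comment> \<open>The second term of the maximum bounding \<open>kA\<close> is at least
    \<open>hM + emin\<close>, because \<open>3 * hM / (hM - 1) \<ge> 1\<close>.\<close>
  have "1 * (real hM + real emin) \<le> 3 * real hM / (real hM - 1) * (real hM + real emin)"
    using hM_ge_2 by (intro mult_right_mono) (auto simp: field_simps)
  then have kA: "hM + emin \<le> kA" using kA_large by (simp add: max_def split: if_splits)
  show ?thesis
  proof (rule AE_infinite_bottleneck[OF b_large kA])
    fix i :: nat assume "1 \<le> i"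
    from kA_free[OF this]
    show "AE \<omega> in P. real (num_tips (W \<omega>) i) \<le> b \<and> event_A hM emin kA (W \<omega>) i \<longrightarrow>
      3 * (hM + emin) < num_free_tips (W \<omega>) (i + kA)"
    proof (rule AE_mp, intro AE_I2 impI)
      fix \<omega>
      assume "real (num_tips (W \<omega>) i) \<le> b \<and> event_A hM emin kA (W \<omega>) i \<longrightarrow>
          3 * (real hM + real emin) < real (num_free_tips (W \<omega>) (i + kA)) - real (num_free_tips (W \<omega>) (i + hM))"
        and "real (num_tips (W \<omega>) i) \<le> b \<and> event_A hM emin kA (W \<omega>) i"
      then have "3 * (real hM + real emin) < real (num_free_tips (W \<omega>) (i + kA)) - real (num_free_tips (W \<omega>) (i + hM))"
        by blast
      then have "real (3 * (hM + emin)) < real (num_free_tips (W \<omega>) (i + kA))"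
        unfolding of_nat_mult of_nat_add of_nat_numeral by linarith
      then show "3 * (hM + emin) < num_free_tips (W \<omega>) (i + kA)" by (simp only: of_nat_less_iff)
    qed
  qed
qed

end
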